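(* There exists a Tychonoff space that is $\mathrm{hL}$-tight but not $\sigma$-compact-tight.
   Context: For a property $\mathcal{P}$ that a subspace of a topological space may have, a space $X$ is called $\mathcal{P}$-tight if for all $x\in X$ and $A\subseteq X$ with $x\in\overline{A}$ there is $B\subseteq A$ such that $x\in\overline{B}$ and $B$ has property $\mathcal{P}$. $\mathrm{hL}$-tight is $\mathcal{P}$-tight for $\mathcal{P}$ = "hereditarily Lindelöf (in the subspace topology)"; $\sigma$-compact-tight is $\mathcal{P}$-tight for $\mathcal{P}$ = "$\sigma$-compact", i.e. a countable union of compact subspaces. *)

theory Defs
  imports "HOL-Analysis.Analysis"
begin

definition Tychonoff_space :: "'a topology \<Rightarrow> bool" where
  "Tychonoff_space X \<longleftrightarrow> completely_regular_space X \<and> Hausdorff_space X"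

definition sigma_compact_space :: "'a topology \<Rightarrow> bool" where
  "sigma_compact_space X \<longleftrightarrow>
     (\<exists>\<K>. countable \<K> \<and> (\<forall>K\<in>\<K>. compactin X K) \<and> \<Union>\<K> = topspace X)"

text \<open>A property of subspaces is a predicate on topologies, evaluated at the subspace topology.\<close>

definition tight_space :: "('a topology \<Rightarrow> bool) \<Rightarrow> 'a topology \<Rightarrow> bool" where
  "tight_space P X \<longleftrightarrow>
     (\<forall>x\<in>topspace X. \<forall>A\<subseteq>topspace X. x \<in> X closure_of A \<longrightarrow>
        (\<exists>B\<subseteq>A. x \<in> X closure_of B \<and> P (subtopology X B)))"

abbreviation hL_tight_space :: "'a topology \<Rightarrow> bool" where
  "hL_tight_space \<equiv> tight_space (hereditarily Lindelof_space)"

abbreviation sigma_compact_tight_space :: "'a topology \<Rightarrow> bool" where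
  "sigma_compact_tight_space \<equiv> tight_space sigma_compact_space"

text \<open>
  HOL cannot quantify existentially over types, so the existence of a space has to be asserted
  over a fixed type of points; we use \<^typ>\<open>real\<close>, as a mere set of cardinality continuum (the
  topology and its carrier are arbitrary). This loses no generality: if \<open>X\<close> is hL-tight but
  not sigma-compact-tight, as witnessed by \<open>x\<close> and \<open>A\<close>, and \<open>B \<subseteq> A\<close> is hereditarily
  Lindelof with \<open>x\<close> in its closure, then the subspace \<open>B \<union> {x}\<close> is again such an example, and
  a hereditarily Lindelof Hausdorff space has at most continuum many points (de Groot).
\<close>

end

(*
  The space is built from Moore's ZFC L-space. Write o(x,b) for the number of oscillations of the
  coherent finite-to-one functions e_x and e_b along the lower trace of the walk from b to x. Given
  an uncountable disjoint family of finite tuples a and an uncountable set of b's, one finds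
  a tuple a and b_0, ..., b_n above it with o(x, b_m) = o(x, b_0) + m for all entries x of a.
  Let w_b(x) = cos (2 pi theta_x (o(x,b) + 1)) for x < b and w_b(x) = 1 for x >= b, where the
  numbers theta_x and 1 are rationally independent. By Kronecker's theorem w_b takes values
  close to prescribed ones on some tuple a, for some b. With a Delta-system argument this makes
  the set of all w_b hereditarily Lindelof, and it puts p, the constant function -1, into
  its closure (after discarding countably many coordinates). The values w_b(x) are never -1,
  whereas uncountably many b's produce values accumulating at -1 in some coordinate; so
  compact sets of points w_b are countable. Finally, p is not in the closure of countably many points
  w_b, since beyond their indices these have coordinates 1.
*)
theory Submission
  imports Defs
begin

section \<open>The first uncountable ordinal\<close>

text \<open>In a hereditarily Lindelof space every set \<open>A\<close> can serve as its own
  \<open>B\<close>, so hL-tightness costs nothing. What remains is a point in the closure of a set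
  but of no sigma-compact subset of it. Where compact subsets of that set are countable, this is a
  failure of countable tightness, so such an example is a regular hereditarily Lindelof space that
  is not hereditarily separable: an L-space. Classical L-spaces (from a Suslin line, say) rest on
  additional axioms, which is why walks on ordinals enter. The value -1 has to be approximable in
  many coordinates at once, yet never attained; rational independence of the frequencies gives both.
  Taking real parts of Moore's circle-valued coordinates places the space inside a power of the real
  line, so that it is Tychonoff. Elementary submodels are replaced by a single ordinal
  \<open>d\<close> closed off against countably many sets. They are countably many because, by
  coherence, the functions \<open>e_b\<close> have only countably many restrictions to a given
  countable ordinal.\<close>

definition real_wo :: "real rel" where
  "real_wo = (SOME r. well_order_on UNIV r)"

lemma well_order_real_wo: "well_order_on UNIV real_wo"
  unfolding real_wo_def by (rule someI_ex) (rule well_order_on)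

text \<open>The first uncountable ordinal, as the initial segment of a well-order of the reals that
  consists of the points with countably many predecessors.\<close>

typedef omega1 = "{x. countable {y. (y, x) \<in> real_wo}}"
proof -
  have wf: "wf (real_wo - Id)" and lin: "linear_order real_wo"
    using well_order_real_wo unfolding well_order_on_def by auto
  obtain x where x: "\<And>y. (y, x) \<in> real_wo - Id \<Longrightarrow> y \<notin> UNIV"
    using wfE_min[OF wf, of 0 UNIV] by blast
  then have "{y. (y, x) \<in> real_wo} \<subseteq> {x}" by auto
  then show ?thesis
    using countable_subset[of _ "{x}"] by auto
qed

instantiation omega1 :: wellorder
begin

definition less_eq_omega1 :: "omega1 \<Rightarrow> omega1 \<Rightarrow> bool" where
  "x \<le> y \<longleftrightarrow> (Rep_omega1 x, Rep_omega1 y) \<in> real_wo"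

definition less_omega1 :: "omega1 \<Rightarrow> omega1 \<Rightarrow> bool" where
  "x < y \<longleftrightarrow> x \<le> y \<and> x \<noteq> (y::omega1)"

instance
proof -
  have lin: "linear_order real_wo" and wf: "wf (real_wo - Id)"
    using well_order_real_wo unfolding well_order_on_def by auto
  have refl: "(a, a) \<in> real_wo" for a
    using lin by (simp add: order_on_defs refl_on_def)
  have trans: "(a, b) \<in> real_wo \<Longrightarrow> (b, c) \<in> real_wo \<Longrightarrow> (a, c) \<in> real_wo" for a b c
    using lin by (meson order_on_defs(1,2,3) transD)
  have anti: "(a, b) \<in> real_wo \<Longrightarrow> (b, a) \<in> real_wo \<Longrightarrow> a = b" for a b
    using lin by (meson order_on_defs(2,3) antisymD)
  have tot: "(a, b) \<in> real_wo \<or> (b, a) \<in> real_wo" for a b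
    using lin refl by (metis UNIV_I order_on_defs(3) total_on_def)
  show "OFCLASS(omega1, wellorder_class)"
  proof
    fix x y z :: omega1
    show "(x < y) = (x \<le> y \<and> \<not> y \<le> x)"
      using anti refl Rep_omega1_inject unfolding less_omega1_def less_eq_omega1_def by metis
    show "x \<le> x" "x \<le> y \<Longrightarrow> y \<le> z \<Longrightarrow> x \<le> z" "x \<le> y \<Longrightarrow> y \<le> x \<Longrightarrow> x = y" "x \<le> y \<or> y \<le> x"
      using refl trans anti tot Rep_omega1_inject unfolding less_eq_omega1_def by metis+
  next
    fix P :: "omega1 \<Rightarrow> bool" and a
    assume step: "\<And>x. (\<And>y. y < x \<Longrightarrow> P y) \<Longrightarrow> P x"
    have "{(x, y). x < y} \<subseteq> inv_image (real_wo - Id) Rep_omega1"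
      by (auto simp: less_omega1_def less_eq_omega1_def Rep_omega1_inject)
    then have "wf {(x, y :: omega1). x < y}"
      using wf_inv_image[OF wf] wf_subset by blast
    then show "P a"
      by (rule wf_induct_rule) (use step in auto)
  qed
qed

end

lemma countable_atMost_omega1: "countable {..x :: omega1}"
proof -
  have "Rep_omega1 ` {..x} \<subseteq> {y. (y, Rep_omega1 x) \<in> real_wo}"
    by (auto simp: less_eq_omega1_def)
  then have "countable (Rep_omega1 ` {..x})"
    using Rep_omega1[of x] countable_subset by auto
  then show ?thesis
    by (rule countable_image_inj_on) (simp add: inj_on_def Rep_omega1_inject)
qed

lemma countable_lessThan_omega1: "countable {..<x :: omega1}"
  by (rule countable_subset[OF _ countable_atMost_omega1[of x]]) auto

text \<open>The least real outside a countable \<open>omega1\<close> would have only itself and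
  members of \<open>omega1\<close> as predecessors, hence would belong to
  \<open>omega1\<close>.\<close>

lemma uncountable_omega1: "uncountable (UNIV :: omega1 set)"
proof
  assume c: "countable (UNIV :: omega1 set)"
  have lin: "linear_order real_wo" and wf: "wf (real_wo - Id)"
    using well_order_real_wo unfolding well_order_on_def by auto
  have cr: "countable (range Rep_omega1)" using c by auto
  then have "range Rep_omega1 \<noteq> UNIV" using uncountable_UNIV_real by metis
  then obtain x0 where "x0 \<in> - range Rep_omega1" by blast
  then obtain x where x: "x \<in> - range Rep_omega1"
    and min: "\<And>y. (y, x) \<in> real_wo - Id \<Longrightarrow> y \<notin> - range Rep_omega1"
    using wfE_min[OF wf] by metis
  have "{y. (y, x) \<in> real_wo} \<subseteq> insert x (range Rep_omega1)" using min by auto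
  then have "countable {y. (y, x) \<in> real_wo}"
    by (rule countable_subset) (use cr in simp)
  then have "x \<in> range Rep_omega1" using type_definition.Rep_range[OF type_definition_omega1] by blast
  then show False using x by simp
qed

lemma bounded_if_countable_omega1:
  fixes S :: "omega1 set"
  assumes "countable S"
  shows "\<exists>u. \<forall>x\<in>S. x < u"
proof (rule ccontr)
  assume "\<nexists>u. \<forall>x\<in>S. x < u"
  then have "UNIV \<subseteq> (\<Union>x\<in>S. {..x})" by (force simp: not_less)
  moreover have "countable (\<Union>x\<in>S. {..x})"
    using assms countable_atMost_omega1 by blast
  ultimately show False
    using uncountable_omega1 countable_subset by blast
qed

lemma gt_ex_omega1: "\<exists>u. (x :: omega1) < u"
  using bounded_if_countable_omega1[of "{x}"] by auto

definition bot_omega1 :: omega1 where "bot_omega1 = (LEAST x. True)"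

lemma bot_omega1_le [simp]: "bot_omega1 \<le> x"
  unfolding bot_omega1_def by (rule Least_le) simp

section \<open>Walks on countable ordinals\<close>

text \<open>The records of an enumeration of the predecessors of \<open>g\<close> form a cofinal subset of order
  type at most \<open>\<omega>\<close>.\<close>

definition ladder :: "omega1 \<Rightarrow> omega1 set" where
  "ladder g = (let f = to_nat_on {..<g} in
     {x. x < g \<and> (x = bot_omega1 \<or> (\<forall>y<g. f y < f x \<longrightarrow> y < x))})"

lemma ladder_less: "c \<in> ladder g \<Longrightarrow> c < g"
  by (simp add: ladder_def Let_def)

text \<open>The least ordinal is put into every ladder so that
  \<open>{c \<in> ladder g. c < a}\<close> is non-empty and its \<open>Max\<close>,
  \<open>ladder_prev a g\<close>, is meaningful.\<close>

lemma bot_omega1_in_ladder: "bot_omega1 < g \<Longrightarrow> bot_omega1 \<in> ladder g"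
  by (simp add: ladder_def Let_def)

text \<open>A record below \<open>a\<close> other than \<open>bot_omega1\<close> cannot be
  enumerated after \<open>a\<close>, so its index is at most that of \<open>a\<close>.\<close>

lemma finite_ladder_less:
  assumes "a < g"
  shows "finite {c \<in> ladder g. c < a}"
proof -
  define f where "f = to_nat_on {..<g}"
  have inj: "inj_on f {..<g}"
    unfolding f_def by (rule inj_on_to_nat_on) (rule countable_lessThan_omega1)
  have "{c \<in> ladder g. c < a} \<subseteq> insert bot_omega1 {c \<in> {..<g}. f c \<in> {..f a}}"
    using assms unfolding ladder_def Let_def f_def[symmetric] by (force simp: not_less)
  moreover have "finite {c \<in> {..<g}. f c \<in> {..f a}}"
    using finite_vimage_IntI[OF _ inj, of "{..f a}"] by (simp add: vimage_def Int_def conj_commute)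
  ultimately show ?thesis by (meson finite_insert finite_subset)
qed

text \<open>The element of \<open>[a, g)\<close> with the least index is a record.\<close>

lemma ladder_cofinal:
  assumes "a < g"
  shows "\<exists>c\<in>ladder g. a \<le> c"
proof -
  define f where "f = to_nat_on {..<g}"
  obtain c where c: "c \<in> {a..<g}" and min: "\<And>y. y \<in> {a..<g} \<Longrightarrow> f c \<le> f y"
    using assms ex_has_least_nat[of "\<lambda>x. x \<in> {a..<g}" a f] by auto
  have "y < c" if "y < g" "f y < f c" for y
    using min[of y] that c by (meson atLeastLessThan_iff leI order_trans not_le)
  then have "c \<in> ladder g"
    using c by (simp add: ladder_def Let_def f_def)
  then show ?thesis using c by auto
qed

text \<open>One step of the minimal walk from \<open>g\<close> towards \<open>a\<close>.\<close>

definition ladder_next :: "omega1 \<Rightarrow> omega1 \<Rightarrow> omega1" where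
  "ladder_next a g = (LEAST c. c \<in> ladder g \<and> a \<le> c)"

definition ladder_prev :: "omega1 \<Rightarrow> omega1 \<Rightarrow> omega1" where
  "ladder_prev a g = Max {c \<in> ladder g. c < a}"

lemma ladder_next:
  assumes "a < g"
  shows "ladder_next a g \<in> ladder g" "a \<le> ladder_next a g" "ladder_next a g < g"
proof -
  have "ladder_next a g \<in> ladder g \<and> a \<le> ladder_next a g"
    unfolding ladder_next_def by (rule LeastI_ex) (use ladder_cofinal[OF assms] in blast)
  then show "ladder_next a g \<in> ladder g" "a \<le> ladder_next a g" "ladder_next a g < g"
    using ladder_less by auto
qed

lemma ladder_next_le: "c \<in> ladder g \<Longrightarrow> a \<le> c \<Longrightarrow> ladder_next a g \<le> c"
  unfolding ladder_next_def by (rule Least_le) simp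

lemma ladder_prev:
  assumes "bot_omega1 < a" "a < g"
  shows "ladder_prev a g \<in> ladder g" "ladder_prev a g < a" "\<And>c. c \<in> ladder g \<Longrightarrow> c < a \<Longrightarrow> c \<le> ladder_prev a g"
proof -
  have "finite {c \<in> ladder g. c < a}" by (rule finite_ladder_less) fact
  moreover have "bot_omega1 \<in> {c \<in> ladder g. c < a}"
    using assms bot_omega1_in_ladder by auto
  ultimately have "ladder_prev a g \<in> {c \<in> ladder g. c < a}"
    unfolding ladder_prev_def using Max_in by blast
  then show "ladder_prev a g \<in> ladder g" "ladder_prev a g < a" by auto
  show "c \<le> ladder_prev a g" if "c \<in> ladder g" "c < a" for c
    unfolding ladder_prev_def using that \<open>finite _\<close> by (intro Max_ge) auto
qed

text \<open>Todorcevic's function \<open>\<rho>\<^sub>1\<close> (the maximal weight of the walk from \<open>g\<close> down to \<open>x\<close>), which is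
  finite-to-one and coherent.\<close>

function rho1 :: "omega1 \<Rightarrow> omega1 \<Rightarrow> nat" where
  "rho1 g x = (if x < g then max (card {c \<in> ladder g. c < x}) (rho1 (ladder_next x g) x) else 0)"
  by auto
termination
  by (relation "inv_image {(x, y). x < y} fst") (auto simp: wf ladder_next)

declare rho1.simps [simp del]

text \<open>No ladder element lies between \<open>x\<close> and the next step. Expressing the weight
  through the step alone lets the inductions below treat all \<open>x\<close> with the same first
  step at once.\<close>

lemma rho1_ladder_next:
  assumes "x < g"
  shows "rho1 g x = max (card {c \<in> ladder g. c < ladder_next x g}) (rho1 (ladder_next x g) x)"
proof -
  have "{c \<in> ladder g. c < ladder_next x g} = {c \<in> ladder g. c < x}"
    using ladder_next[OF assms] ladder_next_le by (force simp: not_less[symmetric])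
  then show ?thesis using assms by (simp add: rho1.simps[of g x])
qed

lemma finite_ladder_card:
  "finite {c \<in> ladder g. card {d \<in> ladder g. d < c} \<le> n}"
proof -
  let ?r = "\<lambda>c. card {d \<in> ladder g. d < c}"
  have mono: "?r c < ?r c'" if "c \<in> ladder g" "c' \<in> ladder g" "c < c'" for c c'
    by (rule psubset_card_mono) (use that finite_ladder_less ladder_less in auto)
  have "inj_on ?r (ladder g)"
  proof (rule linorder_inj_onI')
    fix c c' assume "c \<in> ladder g" "c' \<in> ladder g" "c < c'"
    from mono[OF this] show "?r c \<noteq> ?r c'" by simp
  qed
  from finite_vimage_IntI[OF _ this, of "{..n}"] show ?thesis
    by (simp add: vimage_def Int_def conj_commute)
qed

text \<open>A bound on \<open>rho1 g x\<close> bounds the weight of the first step, which leaves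
  finitely many candidates \<open>c\<close> for it; the induction hypothesis handles each.\<close>

lemma finite_rho1_le: "finite {x. x < g \<and> rho1 g x \<le> n}"
proof (induction g rule: less_induct)
  case (less g)
  let ?F = "{c \<in> ladder g. card {d \<in> ladder g. d < c} \<le> n}"
  have "{x. x < g \<and> rho1 g x \<le> n} \<subseteq> (\<Union>c\<in>?F. insert c {x. x < c \<and> rho1 c x \<le> n})"
  proof
    fix x assume "x \<in> {x. x < g \<and> rho1 g x \<le> n}"
    then have x: "x < g" "rho1 g x \<le> n" by auto
    have "ladder_next x g \<in> ?F" using ladder_next[OF x(1)] rho1_ladder_next[OF x(1)] x(2) by auto
    moreover have "x \<in> insert (ladder_next x g) {y. y < ladder_next x g \<and> rho1 (ladder_next x g) y \<le> n}"
      using ladder_next[OF x(1)] rho1_ladder_next[OF x(1)] x(2) by (auto simp: le_less)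
    ultimately show "x \<in> (\<Union>c\<in>?F. insert c {x. x < c \<and> rho1 c x \<le> n})" by blast
  qed
  moreover have "finite (\<Union>c\<in>?F. insert c {x. x < c \<and> rho1 c x \<le> n})"
    using less.IH ladder_less finite_ladder_card by auto
  ultimately show ?case using finite_subset by blast
qed

text \<open>For \<open>a < g\<close>, walks from \<open>g\<close> to points below \<open>a\<close>
  have finitely many first steps \<open>c\<close>. If \<open>rho1 a x\<close> and
  \<open>rho1 g x\<close> differ, then \<open>x = c\<close>, or the weight of the step exceeds
  \<open>rho1 c x\<close>, or \<open>rho1 a x\<close> and \<open>rho1 c x\<close> differ. The second
  case is finite-to-one-ness, the third is the induction hypothesis, as \<open>a\<close> and
  \<open>c\<close> are below \<open>g\<close>.\<close>

lemma finite_rho1_diff: "finite {x. x < a \<and> x < g \<and> rho1 a x \<noteq> rho1 g x}"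
proof -
  have "\<forall>a<g. finite {x. x < a \<and> rho1 a x \<noteq> rho1 g x}" for g
  proof (induction g rule: less_induct)
    case (less g)
    show ?case
    proof (intro allI impI)
      fix a assume "a < g"
      let ?F = "insert (ladder_next a g) {c \<in> ladder g. c < a}"
      let ?k = "\<lambda>c. card {d \<in> ladder g. d < c}"
      have fin: "finite ?F" using finite_ladder_less[OF \<open>a < g\<close>] by simp
      have Fg: "c < g" if "c \<in> ?F" for c using that ladder_next[OF \<open>a < g\<close>] \<open>a < g\<close> by auto
      have fd: "finite {x. x < a \<and> x < c \<and> rho1 a x \<noteq> rho1 c x}" if "c \<in> ?F" for c
      proof (cases c a rule: linorder_cases)
        case less
        then have "finite {x. x < c \<and> rho1 c x \<noteq> rho1 a x}" using less.IH[of a] \<open>a < g\<close> by blast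
        then show ?thesis by (rule rev_finite_subset) auto
      next
        case greater
        then have "finite {x. x < a \<and> rho1 a x \<noteq> rho1 c x}" using less.IH Fg[OF that] by blast
        then show ?thesis by (rule rev_finite_subset) auto
      qed simp
      have "{x. x < a \<and> rho1 a x \<noteq> rho1 g x} \<subseteq>
        (\<Union>c\<in>?F. insert c ({x. x < c \<and> rho1 c x \<le> ?k c} \<union> {x. x < a \<and> x < c \<and> rho1 a x \<noteq> rho1 c x}))"
      proof
        fix x assume "x \<in> {x. x < a \<and> rho1 a x \<noteq> rho1 g x}"
        then have x: "x < a" "rho1 a x \<noteq> rho1 g x" "x < g" using \<open>a < g\<close> by auto
        have "ladder_next x g \<in> ?F"
          using ladder_next[OF \<open>a < g\<close>] ladder_next[OF x(3)] ladder_next_le[of "ladder_next a g" g x] x(1)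
            ladder_next_le[of "ladder_next x g" g a] by (metis (mono_tags, lifting) dual_order.trans insert_iff
              less_imp_le mem_Collect_eq not_less order_antisym)
        moreover have "x \<in> insert (ladder_next x g) ({y. y < ladder_next x g \<and> rho1 (ladder_next x g) y \<le> ?k (ladder_next x g)} \<union>
             {y. y < a \<and> y < ladder_next x g \<and> rho1 a y \<noteq> rho1 (ladder_next x g) y})"
          using x ladder_next(2)[OF x(3)] rho1_ladder_next[OF x(3)] by (auto simp: le_less max_def split: if_splits)
        ultimately show "x \<in> (\<Union>c\<in>?F. insert c ({x. x < c \<and> rho1 c x \<le> ?k c} \<union>
          {x. x < a \<and> x < c \<and> rho1 a x \<noteq> rho1 c x}))" by blast
      qed
      moreover have "finite (\<Union>c\<in>?F. insert c ({x. x < c \<and> rho1 c x \<le> ?k c} \<union>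
          {x. x < a \<and> x < c \<and> rho1 a x \<noteq> rho1 c x}))"
        using fin fd finite_rho1_le by (intro finite_UN_I) auto
      ultimately show "finite {x. x < a \<and> rho1 a x \<noteq> rho1 g x}" using finite_subset by blast
    qed
  qed
  then have *: "a < g \<Longrightarrow> finite {x. x < a \<and> rho1 a x \<noteq> rho1 g x}" for a g by blast
  show ?thesis
  proof (cases a g rule: linorder_cases)
    case less
    from *[OF less] show ?thesis by (rule rev_finite_subset) auto
  next
    case greater
    from *[OF greater] show ?thesis by (rule rev_finite_subset) auto
  qed simp
qed

text \<open>Moore's lower trace of the walk from \<open>g\<close> down to \<open>a\<close>, as an increasing list. Discarding the
  elements below \<open>ladder_prev a g\<close> makes the whole trace tend to \<open>g\<close> as \<open>a\<close> does.\<close>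

function lower_trace :: "omega1 \<Rightarrow> omega1 \<Rightarrow> omega1 list" where
  "lower_trace a g = (if bot_omega1 < a \<and> a < g
     then ladder_prev a g # filter (\<lambda>x. ladder_prev a g < x) (lower_trace a (ladder_next a g)) else [])"
  by auto
termination
  by (relation "inv_image {(x, y). x < y} snd") (auto simp: wf ladder_next)

declare lower_trace.simps [simp del]

lemma lower_trace_less: "x \<in> set (lower_trace a g) \<Longrightarrow> x < a"
proof (induction a g rule: lower_trace.induct)
  case (1 a g)
  then show ?case by (subst (asm) (2) lower_trace.simps) (auto split: if_splits simp: ladder_prev)
qed

lemma lower_trace_ne: "bot_omega1 < a \<Longrightarrow> a < g \<Longrightarrow> lower_trace a g \<noteq> []"
  by (subst lower_trace.simps) simp

lemma lower_trace_ladder_prev_in: "bot_omega1 < a \<Longrightarrow> a < g \<Longrightarrow> ladder_prev a g \<in> set (lower_trace a g)"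
  by (subst lower_trace.simps) simp

lemma lower_trace_ladder_prev_le: "x \<in> set (lower_trace a g) \<Longrightarrow> ladder_prev a g \<le> x"
  by (subst (asm) lower_trace.simps) (auto split: if_splits)

lemma lower_trace_self [simp]: "lower_trace a a = []"
  by (subst lower_trace.simps) simp

text \<open>On the walk from \<open>g\<close> to \<open>b\<close>, the part of each visited ladder
  below \<open>b\<close> already lies below \<open>a\<close>. So no ladder element falls into
  \<open>[a, b)\<close>, and the walk to \<open>a\<close> takes the same steps until it reaches
  \<open>b\<close>.\<close>

lemma lower_trace_append:
  assumes "bot_omega1 < a" "a < b" "b \<le> g"
    and "\<And>x y. x \<in> set (lower_trace b g) \<Longrightarrow> y \<in> set (lower_trace a b) \<Longrightarrow> x < y"
  shows "lower_trace a g = lower_trace b g @ lower_trace a b"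
  using assms
proof (induction g rule: less_induct)
  case (less g)
  show ?case
  proof (cases "b = g")
    case False
    then have bg: "b < g" "bot_omega1 < b" "a < g" using less.prems by auto
    let ?m = "ladder_prev b g"
    have lt: "?m < y" if "y \<in> set (lower_trace a b)" for y
      using less.prems(4)[OF lower_trace_ladder_prev_in[OF bg(2,1)] that] .
    obtain y where y: "y \<in> set (lower_trace a b)" using lower_trace_ne[OF less.prems(1,2)] by fastforce
    have "?m < a" using lt[OF y] lower_trace_less[OF y] by simp
    have eq: "{c \<in> ladder g. c < a} = {c \<in> ladder g. c < b}"
      using ladder_prev(3)[OF bg(2,1)] \<open>?m < a\<close> \<open>a < b\<close> by (auto intro: le_less_trans)
    then have m: "ladder_prev a g = ?m" by (simp add: ladder_prev_def)
    have "(c \<in> ladder g \<and> a \<le> c) = (c \<in> ladder g \<and> b \<le> c)" for c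
      using eq by (metis (mono_tags, lifting) mem_Collect_eq not_less)
    then have n: "ladder_next a g = ladder_next b g" by (simp add: ladder_next_def)
    have sp: "lower_trace b g = ?m # filter (\<lambda>x. ?m < x) (lower_trace b (ladder_next b g))"
      using bg by (subst lower_trace.simps) simp
    \<comment> \<open>The induction hypothesis also concerns the entries that the filter discards;
      these are at most \<open>?m\<close>.\<close>
    have "x < y" if "x \<in> set (lower_trace b (ladder_next b g))" "y \<in> set (lower_trace a b)" for x y
    proof (cases "?m < x")
      case True
      then have "x \<in> set (lower_trace b g)" unfolding sp using that by simp
      then show ?thesis using less.prems(4) that(2) by blast
    next
      case False then show ?thesis using lt[OF that(2)] by auto
    qed
    then have IH: "lower_trace a (ladder_next b g) = lower_trace b (ladder_next b g) @ lower_trace a b"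
      using less.IH[of "ladder_next b g"] ladder_next[OF bg(1)] less.prems(1,2) by blast
    have "filter (\<lambda>x. ?m < x) (lower_trace a b) = lower_trace a b" using lt by (simp add: filter_id_conv)
    then show ?thesis
      using sp IH m n less.prems(1) bg by (subst lower_trace.simps) simp
  qed simp
qed

text \<open>For \<open>x\<close> above a ladder element \<open>v \<ge> c\<close>, the least entry
  \<open>ladder_prev x d\<close> of the trace is at least \<open>v\<close>.\<close>

lemma lower_trace_tail:
  assumes "c < d"
  shows "\<exists>v<d. \<forall>x. v < x \<longrightarrow> x < d \<longrightarrow> (\<forall>y\<in>set (lower_trace x d). c \<le> y)"
proof -
  obtain v where v: "v \<in> ladder d" "c \<le> v" using ladder_cofinal[OF assms] by blast
  have "c \<le> y" if "v < x" "x < d" "y \<in> set (lower_trace x d)" for x y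
  proof -
    have "bot_omega1 < x" using \<open>v < x\<close> le_less_trans bot_omega1_le by blast
    then have "v \<le> ladder_prev x d" using ladder_prev(3)[OF _ that(2)] v(1) that(1) by blast
    then show ?thesis using lower_trace_ladder_prev_le[OF that(3)] v(2) by auto
  qed
  then show ?thesis using v ladder_less by blast
qed

section \<open>Oscillations\<close>

text \<open>Crossings are counted in one direction only: the return from \<open>t < s\<close> to
  \<open>s \<le> t\<close> is free.\<close>

fun osc :: "(omega1 \<Rightarrow> nat) \<Rightarrow> (omega1 \<Rightarrow> nat) \<Rightarrow> omega1 list \<Rightarrow> nat" where
  "osc s t (x # y # zs) = (if s x \<le> t x \<and> t y < s y then 1 else 0) + osc s t (y # zs)"
| "osc s t xs = 0"

lemma osc_append:
  assumes "xs \<noteq> []" "ys \<noteq> []"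
  shows "osc s t (xs @ ys) = osc s t xs + osc s t ys +
    (if s (last xs) \<le> t (last xs) \<and> t (hd ys) < s (hd ys) then 1 else 0)"
  using assms
proof (induction s t xs rule: osc.induct)
  case ("2_2" s t v)
  then show ?case by (cases ys) auto
qed auto

lemma osc_cong:
  "(\<And>x. x \<in> set xs \<Longrightarrow> s x = s' x \<and> t x = t' x) \<Longrightarrow> osc s t xs = osc s' t' xs"
  by (induction s t xs rule: osc.induct) auto

lemma osc_less: "\<forall>x\<in>set xs. t x < s x \<Longrightarrow> osc s t xs = 0"
  by (induction s t xs rule: osc.induct) auto

lemma osc_le: "(\<And>x. x \<in> set xs \<Longrightarrow> s x \<le> t x) \<Longrightarrow> osc s t xs = 0"
  by (induction s t xs rule: osc.induct) (auto simp: not_less)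

definition osc_number :: "omega1 \<Rightarrow> omega1 \<Rightarrow> nat" where
  "osc_number x b = osc (rho1 x) (rho1 b) (lower_trace x b)"

text \<open>Finite tuples of ordinals are lists. A large family plays the role of an uncountable family
  of pairwise disjoint finite sets.\<close>

definition large :: "omega1 list set \<Rightarrow> bool" where
  "large A \<longleftrightarrow> (\<forall>z. \<exists>a\<in>A. \<forall>x\<in>set a. z < x)"

section \<open>Unbounded sets and reflecting ordinals\<close>

definition unbounded :: "omega1 set \<Rightarrow> bool" where
  "unbounded S \<longleftrightarrow> (\<forall>z. \<exists>x\<in>S. z < x)"

lemma not_unbounded: "\<not> unbounded S \<longleftrightarrow> (\<exists>c. \<forall>x\<in>S. x < c)"
proof
  assume "\<not> unbounded S"
  then obtain z where "\<forall>x\<in>S. x \<le> z" unfolding unbounded_def by (auto simp: not_less)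
  moreover obtain c where "z < c" using gt_ex_omega1 by blast
  ultimately show "\<exists>c. \<forall>x\<in>S. x < c" by (meson le_less_trans)
next
  assume "\<exists>c. \<forall>x\<in>S. x < c"
  then show "\<not> unbounded S" unfolding unbounded_def by (meson less_asym)
qed

text \<open>The fragment of elementarity that the argument uses, in both directions: a set with an
  element \<open>\<ge> d\<close> is unbounded, and a bounded set has a bound already below
  \<open>d\<close>.\<close>

definition reflects :: "omega1 \<Rightarrow> omega1 set \<Rightarrow> bool" where
  "reflects d S \<longleftrightarrow> unbounded S \<or> (\<exists>c<d. \<forall>x\<in>S. x < c)"

lemma reflection:
  fixes D :: "omega1 \<Rightarrow> omega1 set set"
  assumes "\<And>z. countable (D z)"
  shows "\<exists>d. bot_omega1 < d \<and> (\<forall>c<d. \<exists>c'<d. c < c') \<and> (\<forall>z<d. \<forall>S\<in>D z. reflects d S)"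
proof -
  define bnd where "bnd S = (SOME c. \<forall>x\<in>S. x < (c::omega1))" for S
  have bnd: "\<forall>x\<in>S. x < bnd S" if "\<not> unbounded S" for S
    using that someI_ex[of "\<lambda>c. \<forall>x\<in>S. x < c"] unfolding not_unbounded bnd_def by blast
  define G where "G z = insert z (bnd ` (\<Union>y\<in>{..z}. D y))" for z
  have "countable (G z)" for z
    unfolding G_def using assms countable_atMost_omega1 by simp
  then have "\<exists>w. \<forall>y\<in>G z. y < w" for z
    by (rule bounded_if_countable_omega1)
  then obtain nxt where nxt: "\<And>z y. y \<in> G z \<Longrightarrow> y < nxt z" by metis
  define h where "h n = (nxt ^^ n) bot_omega1" for n
  have hS: "h (Suc n) = nxt (h n)" for n by (simp add: h_def)
  have hG: "y \<in> G (h n) \<Longrightarrow> y < h (Suc n)" for n y using nxt hS by simp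
  have ex: "\<exists>u. \<forall>n. h n < u" using bounded_if_countable_omega1[of "range h"] by auto
  define d where "d = (LEAST u. \<forall>n. h n < u)"
  have hd: "h n < d" for n using LeastI_ex[OF ex] unfolding d_def by blast
  have cof: "\<exists>n. z \<le> h n" if "z < d" for z
    using not_less_Least[OF that[unfolded d_def]] by (auto simp: not_less)
  have "bot_omega1 < d" using hd[of 0] by (simp add: h_def)
  moreover have "\<exists>c'<d. c < c'" if "c < d" for c
  proof -
    obtain n where "c \<le> h n" using cof \<open>c < d\<close> by blast
    moreover have "h n < h (Suc n)" by (rule hG) (simp add: G_def)
    ultimately show ?thesis using hd[of "Suc n"] le_less_trans by blast
  qed
  moreover have "reflects d S" if "z < d" "S \<in> D z" for z S
  proof (cases "unbounded S")
    case False
    obtain n where "z \<le> h n" using cof \<open>z < d\<close> by blast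
    then have "bnd S \<in> G (h n)" using that by (auto simp: G_def)
    then have "bnd S < d" using hG hd less_trans by blast
    then show ?thesis unfolding reflects_def using bnd[OF False] by blast
  qed (simp add: reflects_def)
  ultimately show ?thesis by blast
qed

section \<open>Types: restrictions of \<open>rho1\<close> to an initial segment\<close>

definition res :: "omega1 \<Rightarrow> (omega1 \<Rightarrow> nat) \<Rightarrow> omega1 \<Rightarrow> nat" where
  "res c f = (\<lambda>x. if x < c then f x else 0)"

lemma resD: "res c f = res c g \<Longrightarrow> x < c \<Longrightarrow> f x = g x"
  unfolding res_def by meson

definition types_at :: "omega1 \<Rightarrow> (omega1 \<Rightarrow> nat) set" where
  "types_at c = (\<lambda>b. res c (rho1 b)) ` {c..}"

text \<open>By coherence, \<open>rho1 b\<close> differs from \<open>rho1 c\<close> at finitely many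
  places below \<open>c\<close>. The finite graph \<open>ph b\<close> of the exceptional values
  determines the restriction, and \<open>ps\<close> recovers it.\<close>

lemma countable_types_at: "countable (types_at c)"
proof -
  define ph where "ph b = {(x, rho1 b x) | x. x < c \<and> rho1 b x \<noteq> rho1 c x}" for b
  define ps where "ps F x = (if x < c then if \<exists>n. (x, n) \<in> F then (SOME n. (x, n) \<in> F) else rho1 c x else 0)"
    for F and x :: omega1
  have "ps (ph b) x = res c (rho1 b) x" for b x
    by (cases "x < c"; cases "rho1 b x = rho1 c x") (auto simp: ps_def ph_def res_def)
  then have "ps (ph b) = res c (rho1 b)" for b by (rule ext)
  then have "types_at c = ps ` ph ` {c..}" by (simp add: types_at_def image_image)
  moreover have "ph ` {c..} \<subseteq> {F. finite F \<and> F \<subseteq> {..<c} \<times> UNIV}"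
  proof
    fix F assume "F \<in> ph ` {c..}"
    then obtain b where b: "c \<le> b" "F = ph b" by auto
    have "ph b = (\<lambda>x. (x, rho1 b x)) ` {x. x < c \<and> x < b \<and> rho1 c x \<noteq> rho1 b x}"
      using b(1) by (auto simp: ph_def)
    then have "finite (ph b)" using finite_rho1_diff by simp
    then show "F \<in> {F. finite F \<and> F \<subseteq> {..<c} \<times> UNIV}" using b by (auto simp: ph_def)
  qed
  moreover have "countable {F. finite F \<and> F \<subseteq> {..<c} \<times> (UNIV :: nat set)}"
    by (intro countable_Collect_finite_subset countable_SIGMA countable_lessThan_omega1) simp
  ultimately have "countable (ph ` {c..})" using countable_subset by blast
  with \<open>types_at c = ps ` ph ` {c..}\<close> show ?thesis by simp
qed

definition type_at :: "omega1 \<Rightarrow> omega1 list \<Rightarrow> (omega1 \<Rightarrow> nat) list" where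
  "type_at c a = map (\<lambda>x. res c (rho1 x)) a"

lemma type_at_length: "type_at c a = type_at c a' \<Longrightarrow> length a = length a'"
  unfolding type_at_def by (metis length_map)

lemma type_atD:
  assumes "type_at c a = type_at c a'" "i < length a" "y < c"
  shows "rho1 (a ! i) y = rho1 (a' ! i) y"
proof -
  have "type_at c a ! i = type_at c a' ! i" using assms(1) by simp
  then have "res c (rho1 (a ! i)) = res c (rho1 (a' ! i))"
    using assms(2) type_at_length[OF assms(1)] by (simp add: type_at_def)
  then show ?thesis using assms(3) by (rule resD)
qed

lemma res_in_types_at: "c \<le> b \<Longrightarrow> res c (rho1 b) \<in> types_at c"
  unfolding types_at_def by auto

lemma type_at_in_types_at:
  assumes "\<And>x. x \<in> set a \<Longrightarrow> c \<le> x"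
  shows "type_at c a \<in> lists (types_at c)"
  using res_in_types_at[OF assms] unfolding type_at_def by auto

text \<open>The source of blocks on which tuples exceed \<open>b\<close>: \<open>F\<close> will be a
  new block of a trace and \<open>m\<close> the maximum of \<open>rho1 b\<close> on it. A threshold
  \<open>g\<close> is unavoidable, since in families of a fixed type the values below some
  \<open>c\<close> are prescribed.\<close>

definition escapes :: "omega1 list set \<Rightarrow> omega1 \<Rightarrow> bool" where
  "escapes A g \<longleftrightarrow> (\<forall>F m z. finite F \<longrightarrow> (\<forall>y\<in>F. g \<le> y) \<longrightarrow>
     (\<exists>a\<in>A. \<forall>x\<in>set a. z \<le> x \<and> (\<forall>y\<in>F. m < rho1 x y)))"

lemma escapes_mono: "escapes A g \<Longrightarrow> g \<le> g' \<Longrightarrow> escapes A g'"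
  unfolding escapes_def
proof (intro allI impI)
  fix F m z
  assume "g \<le> g'"
  assume *: "\<forall>F m z. finite F \<longrightarrow> (\<forall>y\<in>F. g \<le> y) \<longrightarrow>
      (\<exists>a\<in>A. \<forall>x\<in>set a. z \<le> x \<and> (\<forall>y\<in>F. m < rho1 x y))"
    and "finite F" "\<forall>y\<in>F. g' \<le> y"
  have "\<forall>y\<in>F. g \<le> y" using order_trans[OF \<open>g \<le> g'\<close>] \<open>\<forall>y\<in>F. g' \<le> y\<close> by simp
  then show "\<exists>a\<in>A. \<forall>x\<in>set a. z \<le> x \<and> (\<forall>y\<in>F. m < rho1 x y)"
    by (intro *[THEN spec[of _ F], THEN spec[of _ m], THEN spec[of _ z], THEN mp, THEN mp] \<open>finite F\<close>)
qed

lemma large_imp_escapes: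
  assumes "large A"
  shows "\<exists>g. escapes A g"
proof (rule ccontr)
  assume neg: "\<nexists>g. escapes A g"
  define bad where "bad m F z \<longleftrightarrow> (\<forall>a\<in>A. (\<forall>x\<in>set a. z \<le> x) \<longrightarrow>
     (\<exists>x\<in>set a. \<exists>y\<in>F. rho1 x y \<le> m))" for m F z
  have 1: "\<exists>m F z. finite F \<and> (\<forall>y\<in>F. g \<le> y) \<and> bad m F z" for g
    using spec[OF neg[unfolded not_ex], of g] unfolding escapes_def bad_def not_all not_imp not_le[symmetric]
    by fastforce
  \<comment> \<open>One \<open>m\<close> fails for all \<open>g\<close>: if every \<open>m\<close>
    had a threshold \<open>g m\<close> that works, an upper bound \<open>u\<close> of these
    countably many would work for all of them.\<close>
  have "\<exists>m. \<forall>g. \<exists>F z. finite F \<and> (\<forall>y\<in>F. g \<le> y) \<and> bad m F z"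
  proof (rule ccontr)
    assume "\<not> ?thesis"
    then obtain g where g: "\<And>m F z. finite F \<Longrightarrow> (\<forall>y\<in>F. g m \<le> y) \<Longrightarrow> \<not> bad m F z" by metis
    obtain u where u: "\<And>m::nat. g m < u" using bounded_if_countable_omega1[of "range g"] by auto
    obtain m F z where "finite F" "\<forall>y\<in>F. u \<le> y" "bad m F z" using 1[of u] by blast
    then show False using g[of F m z] u[of m] by (meson less_imp_le order_trans)
  qed
  txt \<open>Infinitely many disjoint blocks \<open>F\<close>, each meeting the fibre \<open>{y. rho1 x y \<le> m}\<close> of an
    entry \<open>x\<close> of one and the same tuple, contradict finiteness of the fibres.\<close>
  then obtain m F z where F: "\<And>g. finite (F g)" "\<And>g y. y \<in> F g \<Longrightarrow> g \<le> y"
    and bad: "\<And>g. bad m (F g) (z g)" by metis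
  have "\<exists>w. \<forall>y\<in>insert g (F g). y < w" for g
    by (rule bounded_if_countable_omega1) (simp add: F uncountable_infinite countable_finite)
  then obtain nxt where nxt: "\<And>g y. y \<in> insert g (F g) \<Longrightarrow> y < nxt g" by metis
  define h where "h n = (nxt ^^ n) bot_omega1" for n
  have hS: "h (Suc n) = nxt (h n)" for n by (simp add: h_def)
  have "strict_mono h" by (rule strict_monoI_Suc) (use nxt hS in simp)
  have "\<exists>u. \<forall>x\<in>(\<Union>n. insert (h n) (insert (z (h n)) (F (h n)))). x < u"
    by (rule bounded_if_countable_omega1) (simp add: F countable_finite)
  then obtain u where u: "\<And>n. z (h n) < u" "\<And>n y. y \<in> F (h n) \<Longrightarrow> y < u" by blast
  obtain a where a: "a \<in> A" "\<And>x. x \<in> set a \<Longrightarrow> u < x"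
    using assms unfolding large_def by blast
  have "\<exists>x\<in>set a. \<exists>y\<in>F (h n). rho1 x y \<le> m" for n
  proof -
    have "\<forall>x\<in>set a. z (h n) \<le> x" using a(2) u(1)[of n] by (meson less_imp_le less_trans)
    then show ?thesis using bad[of "h n"] a(1) unfolding bad_def by blast
  qed
  then obtain y where y: "\<And>n. y n \<in> F (h n)" "\<And>n. \<exists>x\<in>set a. rho1 x (y n) \<le> m" by metis
  have hy: "h n \<le> y n" "y n < h (Suc n)" for n
    using y(1)[of n] F(2) nxt hS by auto
  have "strict_mono y"
    by (rule strict_monoI_Suc) (use hy less_le_trans in blast)
  then have "inj y" by (rule strict_mono_imp_inj_on)
  moreover have "range y \<subseteq> (\<Union>x\<in>set a. {v. v < x \<and> rho1 x v \<le> m})"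
  proof
    fix w assume "w \<in> range y"
    then obtain n where n: "w = y n" by blast
    obtain x where x: "x \<in> set a" "rho1 x (y n) \<le> m" using y(2)[of n] by blast
    have "y n < x" using u(2)[OF y(1)[of n]] a(2)[OF x(1)] by (rule less_trans)
    then show "w \<in> (\<Union>x\<in>set a. {v. v < x \<and> rho1 x v \<le> m})" using n x by blast
  qed
  moreover have "finite (\<Union>x\<in>set a. {v. v < x \<and> rho1 x v \<le> m})" using finite_rho1_le by simp
  ultimately show False using finite_subset finite_imageD infinite_UNIV_nat by blast
qed

text \<open>For suitable parameters \<open>d\<close> itself is a member, witnessed by a given tuple
  and \<open>b\<close> above it. As the parameters are bounded by ordinals below \<open>d\<close>,
  there is also a copy \<open>d' > d\<close>, and the walk down to \<open>d\<close> through
  \<open>d'\<close> has a longer trace.\<close>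

definition copies :: "omega1 list set \<Rightarrow> omega1 set \<Rightarrow> omega1 \<Rightarrow> omega1 \<Rightarrow> omega1 \<Rightarrow> (omega1 \<Rightarrow> nat) list
    \<Rightarrow> (omega1 \<Rightarrow> nat) \<Rightarrow> omega1 list \<Rightarrow> omega1 set" where
  "copies A B c c' v s t l = {d. \<exists>a\<in>A. \<exists>b\<in>B. (\<forall>x\<in>set a. d \<le> x) \<and> d \<le> b \<and> type_at c a = s
     \<and> res c (rho1 b) = t \<and> lower_trace d b = l
     \<and> (\<forall>y. c \<le> y \<longrightarrow> y < d \<longrightarrow> rho1 b y = rho1 d y \<and> (\<forall>x\<in>set a. rho1 x y = rho1 d y))
     \<and> (\<forall>x. v < x \<longrightarrow> x < d \<longrightarrow> (\<forall>y\<in>set (lower_trace x d). c' \<le> y))}"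

definition of_type :: "omega1 list set \<Rightarrow> omega1 \<Rightarrow> (omega1 \<Rightarrow> nat) list \<Rightarrow> omega1 list set" where
  "of_type A c s = {a \<in> A. type_at c a = s}"

text \<open>These closure properties of \<open>d\<close> replace the countable elementary submodel of the usual
  argument: a set defined from parameters below \<open>d\<close> that has an element \<open>\<ge> d\<close> is unbounded.\<close>

locale reflecting =
  fixes A :: "omega1 list set" and B :: "omega1 set" and d :: omega1
  assumes bot_omega1_less: "bot_omega1 < d"
    and limit: "c < d \<Longrightarrow> \<exists>c'<d. c < c'"
    and copies: "\<lbrakk>c < d; c' < d; v < d; s \<in> lists (types_at c); t \<in> types_at c; set l \<subseteq> {..<c}\<rbrakk> \<Longrightarrow>
      reflects d (copies A B c c' v s t l)"
    and above: "\<lbrakk>c < d; s \<in> lists (types_at c)\<rbrakk> \<Longrightarrow>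
      reflects d {x. \<exists>a\<in>of_type A c s. \<forall>y\<in>set a. x \<le> y}"
    and esc: "\<lbrakk>c < d; s \<in> lists (types_at c)\<rbrakk> \<Longrightarrow>
      reflects d {x. \<not> escapes (of_type A c s) x}"
    and between: "\<lbrakk>c < d; v < d; s \<in> lists (types_at c)\<rbrakk> \<Longrightarrow>
      reflects d {x. \<not> (\<exists>a\<in>of_type A c s. \<forall>y\<in>set a. v < y \<and> y \<le> x)}"

text \<open>Coherence enters through the countability of types: it leaves only countably many sets
  with parameters up to \<open>z\<close>.\<close>

lemma reflecting_ex: "\<exists>d. reflecting A B d"
proof -
  define T where "T z = (\<Union>c\<in>{..z}. lists (types_at c))" for z
  define T' where "T' z = (\<Union>c\<in>{..z}. types_at c)" for z
  have T: "countable (T z)" "countable (T' z)" for z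
    unfolding T_def T'_def by (auto intro!: countable_UN countable_types_at countable_atMost_omega1)
  define D where "D z =
    (\<lambda>(c, c', v, s, t, l). copies A B c c' v s t l) ` ({..z} \<times> {..z} \<times> {..z} \<times> T z \<times> T' z \<times> lists {..z})
    \<union> (\<lambda>(c, s). {x. \<exists>a\<in>of_type A c s. \<forall>y\<in>set a. x \<le> y}) ` ({..z} \<times> T z)
    \<union> (\<lambda>(c, s). {x. \<not> escapes (of_type A c s) x}) ` ({..z} \<times> T z)
    \<union> (\<lambda>(c, v, s). {x. \<not> (\<exists>a\<in>of_type A c s. \<forall>y\<in>set a. v < y \<and> y \<le> x)}) ` ({..z} \<times> {..z} \<times> T z)"
    for z
  have "countable (D z)" for z
    unfolding D_def
    by (intro countable_Un countable_image countable_SIGMA countable_lists T countable_atMost_omega1)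
  from reflection[of D, OF this] obtain d where d: "bot_omega1 < d" "\<forall>c<d. \<exists>c'<d. c < c'"
    and r: "\<And>z S. z < d \<Longrightarrow> S \<in> D z \<Longrightarrow> reflects d S" by blast
  have "reflecting A B d"
  proof
    fix c c' v s t l
    assume *: "c < d" "c' < d" "v < d" "s \<in> lists (types_at c)" "t \<in> types_at c" "set l \<subseteq> {..<c}"
    let ?z = "max c (max c' v)"
    have "s \<in> T ?z" "t \<in> T' ?z" "l \<in> lists {..?z}"
      using * by (auto simp: T_def T'_def le_max_iff_disj less_imp_le)
    then have "copies A B c c' v s t l \<in> D ?z"
      unfolding D_def by (intro UnI1 image_eqI[where x = "(c, c', v, s, t, l)"]) (auto simp: le_max_iff_disj)
    then show "reflects d (copies A B c c' v s t l)" by (rule r[rotated]) (use * in auto)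
  next
    fix c s assume *: "c < d" "s \<in> lists (types_at c)"
    have s: "s \<in> T c" using * by (auto simp: T_def)
    show "reflects d {x. \<exists>a\<in>of_type A c s. \<forall>y\<in>set a. x \<le> y}"
      by (rule r[OF *(1)], unfold D_def, rule UnI1, rule UnI1, rule UnI2) (use s in force)
    show "reflects d {x. \<not> escapes (of_type A c s) x}"
      by (rule r[OF *(1)], unfold D_def, rule UnI1, rule UnI2) (use s in force)
  next
    fix c v s assume *: "c < d" "v < d" "s \<in> lists (types_at c)"
    have s: "s \<in> T (max c v)" using * by (auto simp: T_def le_max_iff_disj)
    show "reflects d {x. \<not> (\<exists>a\<in>of_type A c s. \<forall>y\<in>set a. v < y \<and> y \<le> x)}"
      by (rule r[of "max c v"]) (use * in simp, unfold D_def, rule UnI2,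
          rule image_eqI[where x = "(c, v, s)"], use s in auto)
  qed (use d in auto)
  then show ?thesis ..
qed

section \<open>Lengthening traces and counting oscillations\<close>

context reflecting
begin

lemma bound_finite:
  assumes "finite S" "\<And>x. x \<in> S \<Longrightarrow> x < d"
  shows "\<exists>c<d. \<forall>x\<in>S. x < c"
proof (cases "S = {}")
  case False
  then have "Max S < d" using assms by simp
  then obtain c where "c < d" "Max S < c" using limit by blast
  then show ?thesis using assms(1) Max_ge le_less_trans by blast
qed (use bot_omega1_less in auto)

lemma agreement:
  assumes "finite X" "\<And>x. x \<in> X \<Longrightarrow> d \<le> x" "finite S" "\<And>x. x \<in> S \<Longrightarrow> x < d"
  shows "\<exists>c<d. (\<forall>x\<in>S. x < c) \<and> (\<forall>x\<in>X. \<forall>y. c \<le> y \<longrightarrow> y < d \<longrightarrow> rho1 x y = rho1 d y)"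
proof -
  have "\<exists>c<d. \<forall>y \<in> S \<union> (\<Union>x\<in>X. {y. y < x \<and> y < d \<and> rho1 x y \<noteq> rho1 d y}). y < c"
    by (rule bound_finite) (use assms finite_rho1_diff in auto)
  then obtain c where c: "c < d" "\<And>y. y \<in> S \<Longrightarrow> y < c"
    "\<And>x y. x \<in> X \<Longrightarrow> y < x \<Longrightarrow> y < d \<Longrightarrow> rho1 x y \<noteq> rho1 d y \<Longrightarrow> y < c" by blast
  have "rho1 x y = rho1 d y" if "x \<in> X" "c \<le> y" "y < d" for x y
    using c(3)[OF that(1) _ that(3)] assms(2)[OF that(1)] that by (meson leD less_le_trans)
  then show ?thesis using c by blast
qed

text \<open>The tuple \<open>a\<close> shows that \<open>d\<close> lies in the reflected set, which
  is therefore unbounded.\<close>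

lemma large_of_type:
  assumes "a \<in> A" "\<And>x. x \<in> set a \<Longrightarrow> d \<le> x" "c < d"
  shows "large (of_type A c (type_at c a))"
proof -
  let ?S = "{x. \<exists>a'\<in>of_type A c (type_at c a). \<forall>y\<in>set a'. x \<le> y}"
  have "type_at c a \<in> lists (types_at c)"
    by (rule type_at_in_types_at) (use assms in \<open>meson less_imp_le order_trans\<close>)
  then have "reflects d ?S" using above assms(3) by blast
  moreover have "d \<in> ?S" using assms by (auto simp: of_type_def)
  ultimately have "unbounded ?S" unfolding reflects_def by (meson less_asym)
  show ?thesis unfolding large_def
  proof
    fix z
    obtain x where "x \<in> ?S" "z < x" using \<open>unbounded ?S\<close> unfolding unbounded_def by blast
    then show "\<exists>a'\<in>of_type A c (type_at c a). \<forall>y\<in>set a'. z < y" using less_le_trans by blast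
  qed
qed

text \<open>A copy \<open>d' > d\<close> comes with \<open>a'\<close>, \<open>b'\<close> of the same
  types and the same trace down to \<open>d'\<close>. Since the old trace lies below
  \<open>c\<close> and the trace from \<open>d'\<close> to \<open>d\<close> above \<open>c'\<close>,
  the latter is appended. On it both \<open>b'\<close> and the entries of \<open>a'\<close> agree
  with \<open>rho1 d'\<close>. The freedom in \<open>c'\<close> pushes the new block as high below
  \<open>d\<close> as desired.\<close>

lemma extension:
  assumes a: "a \<in> A" "\<And>x. x \<in> set a \<Longrightarrow> d \<le> x" and b: "b \<in> B" "d \<le> b"
  shows "\<exists>c<d. (\<forall>y\<in>set (lower_trace d b). y < c) \<and> (\<forall>c'<d. c \<le> c' \<longrightarrow>
    (\<exists>a'\<in>A. \<exists>b'\<in>B. \<exists>l. (\<forall>x\<in>set a'. d \<le> x) \<and> d \<le> b' \<and> type_at c a' = type_at c a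
      \<and> res c (rho1 b') = res c (rho1 b) \<and> lower_trace d b' = lower_trace d b @ l \<and> l \<noteq> []
      \<and> (\<forall>y\<in>set l. c' \<le> y \<and> (\<forall>x\<in>set a'. rho1 x y = rho1 b' y))))"
proof -
  obtain c where c: "c < d" "\<And>y. y \<in> set (lower_trace d b) \<Longrightarrow> y < c"
    and ag: "\<And>x y. x \<in> insert b (set a) \<Longrightarrow> c \<le> y \<Longrightarrow> y < d \<Longrightarrow> rho1 x y = rho1 d y"
    using agreement[of "insert b (set a)" "set (lower_trace d b)"] a b lower_trace_less by blast
  have "\<exists>a'\<in>A. \<exists>b'\<in>B. \<exists>l. (\<forall>x\<in>set a'. d \<le> x) \<and> d \<le> b' \<and> type_at c a' = type_at c a
      \<and> res c (rho1 b') = res c (rho1 b) \<and> lower_trace d b' = lower_trace d b @ l \<and> l \<noteq> []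
      \<and> (\<forall>y\<in>set l. c' \<le> y \<and> (\<forall>x\<in>set a'. rho1 x y = rho1 b' y))"
    if c': "c' < d" "c \<le> c'" for c'
  proof -
    obtain v where v: "v < d" "\<And>x y. v < x \<Longrightarrow> x < d \<Longrightarrow> y \<in> set (lower_trace x d) \<Longrightarrow> c' \<le> y"
      using lower_trace_tail[OF c'(1)] by blast
    let ?S = "copies A B c c' v (type_at c a) (res c (rho1 b)) (lower_trace d b)"
    have "d \<in> ?S" unfolding copies_def using a b v ag by blast
    moreover have "reflects d ?S"
      using c c' v b a by (intro copies type_at_in_types_at res_in_types_at) (auto intro: order_trans less_imp_le)
    ultimately have "unbounded ?S" unfolding reflects_def by (meson less_asym)
    then obtain d' where d': "d' \<in> ?S" "d < d'" unfolding unbounded_def by blast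
    then obtain a' b' where a': "a' \<in> A" "\<And>x. x \<in> set a' \<Longrightarrow> d' \<le> x" "type_at c a' = type_at c a"
      and b': "b' \<in> B" "d' \<le> b'" "res c (rho1 b') = res c (rho1 b)" "lower_trace d' b' = lower_trace d b"
      and ag': "\<And>y. c \<le> y \<Longrightarrow> y < d' \<Longrightarrow> rho1 b' y = rho1 d' y \<and> (\<forall>x\<in>set a'. rho1 x y = rho1 d' y)"
      and tail: "\<And>x y. v < x \<Longrightarrow> x < d' \<Longrightarrow> y \<in> set (lower_trace x d') \<Longrightarrow> c' \<le> y"
      unfolding copies_def by blast
    let ?l = "lower_trace d d'"
    have l: "c' \<le> y" "y < d" if "y \<in> set ?l" for y
      using tail[OF v(1) d'(2) that] lower_trace_less[OF that] by auto
    have "lower_trace d b' = lower_trace d' b' @ ?l"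
      using b'(2,4) bot_omega1_less d'(2) c(2) l(1) c'(2)
      by (intro lower_trace_append) (auto intro: less_le_trans order_trans)
    moreover have "\<forall>y\<in>set ?l. c' \<le> y \<and> (\<forall>x\<in>set a'. rho1 x y = rho1 b' y)"
      using l ag' d'(2) c'(2) by (metis less_trans order_trans)
    moreover have "?l \<noteq> []" using lower_trace_ne bot_omega1_less d'(2) by blast
    moreover have "\<forall>x\<in>set a'. d \<le> x" "d \<le> b'"
      using a'(2) b'(2) d'(2) by (meson less_imp_le order_trans)+
    ultimately show ?thesis using a' b' by metis
  qed
  then show ?thesis using c by blast
qed

lemma extend_eq:
  assumes a: "a \<in> A" "\<And>x. x \<in> set a \<Longrightarrow> d \<le> x" and b: "b \<in> B" "d \<le> b"
  shows "\<exists>a'\<in>A. \<exists>b'\<in>B. \<exists>l. (\<forall>x\<in>set a'. d \<le> x) \<and> d \<le> b' \<and> length a' = length a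
      \<and> lower_trace d b' = lower_trace d b @ l \<and> l \<noteq> []
      \<and> (\<forall>y\<in>set (lower_trace d b). rho1 b' y = rho1 b y \<and> (\<forall>i<length a. rho1 (a' ! i) y = rho1 (a ! i) y))
      \<and> (\<forall>y\<in>set l. \<forall>x\<in>set a'. rho1 x y = rho1 b' y)"
proof -
  obtain c where "c < d" "\<forall>y\<in>set (lower_trace d b). y < c"
    and *: "\<forall>c'<d. c \<le> c' \<longrightarrow> (\<exists>a'\<in>A. \<exists>b'\<in>B. \<exists>l. (\<forall>x\<in>set a'. d \<le> x) \<and> d \<le> b' \<and> type_at c a' = type_at c a
      \<and> res c (rho1 b') = res c (rho1 b) \<and> lower_trace d b' = lower_trace d b @ l \<and> l \<noteq> []
      \<and> (\<forall>y\<in>set l. c' \<le> y \<and> (\<forall>x\<in>set a'. rho1 x y = rho1 b' y)))"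
    using extension[OF assms] by blast
  from * \<open>c < d\<close> obtain a' b' l where "a' \<in> A" "b' \<in> B" "\<forall>x\<in>set a'. d \<le> x" "d \<le> b'"
    and t: "type_at c a' = type_at c a" "res c (rho1 b') = res c (rho1 b)"
    and "lower_trace d b' = lower_trace d b @ l" "l \<noteq> []" "\<forall>y\<in>set l. \<forall>x\<in>set a'. rho1 x y = rho1 b' y" by blast
  moreover have "\<forall>y\<in>set (lower_trace d b). rho1 b' y = rho1 b y \<and> (\<forall>i<length a. rho1 (a' ! i) y = rho1 (a ! i) y)"
    using type_atD[OF t(1)] type_at_length[OF t(1)] resD[OF t(2)] \<open>\<forall>y\<in>set (lower_trace d b). y < c\<close> by simp
  ultimately show ?thesis using type_at_length[OF t(1)] by blast
qed

text \<open>Thresholds at which tuples of the type of \<open>a\<close> do not escape are bounded,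
  hence by reflection some \<open>g' < d\<close> works. The new block is taken beyond
  \<open>g'\<close>; \<open>b'\<close> is kept, and the tuple is exchanged for one of the same type
  that exceeds \<open>rho1 b'\<close> on the block.\<close>

lemma extend_gt:
  assumes a: "a \<in> A" "\<And>x. x \<in> set a \<Longrightarrow> d \<le> x" and b: "b \<in> B" "d \<le> b"
  shows "\<exists>a'\<in>A. \<exists>b'\<in>B. \<exists>l. (\<forall>x\<in>set a'. d \<le> x) \<and> d \<le> b' \<and> length a' = length a
      \<and> lower_trace d b' = lower_trace d b @ l \<and> l \<noteq> []
      \<and> (\<forall>y\<in>set (lower_trace d b). rho1 b' y = rho1 b y \<and> (\<forall>i<length a. rho1 (a' ! i) y = rho1 (a ! i) y))
      \<and> (\<forall>y\<in>set l. \<forall>x\<in>set a'. rho1 b' y < rho1 x y)"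
proof -
  obtain c where c: "c < d" "\<forall>y\<in>set (lower_trace d b). y < c"
    and *: "\<forall>c'<d. c \<le> c' \<longrightarrow> (\<exists>a'\<in>A. \<exists>b'\<in>B. \<exists>l. (\<forall>x\<in>set a'. d \<le> x) \<and> d \<le> b' \<and> type_at c a' = type_at c a
      \<and> res c (rho1 b') = res c (rho1 b) \<and> lower_trace d b' = lower_trace d b @ l \<and> l \<noteq> []
      \<and> (\<forall>y\<in>set l. c' \<le> y \<and> (\<forall>x\<in>set a'. rho1 x y = rho1 b' y)))"
    using extension[OF assms] by blast
  let ?A = "of_type A c (type_at c a)"
  obtain g where "escapes ?A g"
    using large_imp_escapes large_of_type[OF a c(1)] by blast
  then have "{x. \<not> escapes ?A x} \<subseteq> {..<g}"
    using escapes_mono by (auto simp: not_less[symmetric])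
  then have "\<not> unbounded {x. \<not> escapes ?A x}" unfolding not_unbounded by auto
  moreover have "reflects d {x. \<not> escapes ?A x}"
    by (intro esc c(1) type_at_in_types_at) (use a c in \<open>meson less_imp_le order_trans\<close>)
  ultimately obtain g' where g': "g' < d" "escapes ?A g'"
    unfolding reflects_def by blast
  let ?c = "max c g'"
  have "?c < d" "c \<le> ?c" using c g' by auto
  with * obtain b' l where b': "b' \<in> B" "d \<le> b'" "res c (rho1 b') = res c (rho1 b)"
    and l: "lower_trace d b' = lower_trace d b @ l" "l \<noteq> []" "\<And>y. y \<in> set l \<Longrightarrow> ?c \<le> y" by metis
  have "\<forall>y\<in>set l. g' \<le> y" using l(3) by auto
  then have "\<exists>a\<in>?A. \<forall>x\<in>set a. d \<le> x \<and> (\<forall>y\<in>set l. Max (rho1 b' ` set l) < rho1 x y)"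
    by (intro g'(2)[unfolded escapes_def, THEN spec[of _ "set l"], THEN spec[of _ "Max (rho1 b' ` set l)"],
          THEN spec[of _ d], THEN mp, THEN mp] finite_set)
  then obtain a' where a': "a' \<in> ?A" "\<And>x. x \<in> set a' \<Longrightarrow> d \<le> x"
    "\<And>x y. x \<in> set a' \<Longrightarrow> y \<in> set l \<Longrightarrow> Max (rho1 b' ` set l) < rho1 x y"
    by blast
  have "rho1 b' y < rho1 x y" if "x \<in> set a'" "y \<in> set l" for x y
    by (rule le_less_trans[OF Max_ge a'(3)[OF that]]) (use that(2) in auto)
  moreover have t: "type_at c a' = type_at c a" "a' \<in> A" using a'(1) by (auto simp: of_type_def)
  moreover have "\<forall>y\<in>set (lower_trace d b). rho1 b' y = rho1 b y \<and> (\<forall>i<length a. rho1 (a' ! i) y = rho1 (a ! i) y)"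
    using type_atD[OF t(1)] type_at_length[OF t(1)] resD[OF b'(3)] c(2) by simp
  ultimately show ?thesis using type_at_length[OF t(1)] a'(2) b'(1,2) l(1,2) by blast
qed

text \<open>Extending the trace by a block where \<open>a\<close> exceeds \<open>b\<close>, then by one where they agree, creates
  exactly one new oscillation.\<close>

lemma chain:
  assumes "large A" "unbounded B"
  shows "\<exists>a\<in>A. \<exists>bs. (\<forall>x\<in>set a. d \<le> x) \<and> (\<forall>m\<le>n. bs m \<in> B \<and> d \<le> bs m \<and> lower_trace d (bs m) \<noteq> []
    \<and> set (lower_trace d (bs m)) \<subseteq> set (lower_trace d (bs n))
    \<and> (\<forall>i<length a. rho1 (a ! i) (last (lower_trace d (bs m))) \<le> rho1 (bs m) (last (lower_trace d (bs m)))
       \<and> osc (rho1 (a ! i)) (rho1 (bs m)) (lower_trace d (bs m)) = osc (rho1 (a ! i)) (rho1 (bs 0)) (lower_trace d (bs 0)) + m))"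
proof (induction n)
  case 0
  obtain a b where ab: "a \<in> A" "\<And>x. x \<in> set a \<Longrightarrow> d \<le> x" "b \<in> B" "d \<le> b"
    using assms unfolding large_def unbounded_def by (meson less_imp_le)
  \<comment> \<open>An agreeing block at the end establishes the invariant \<open>\<le>\<close> at
    the last entry, without which the next crossing would not count.\<close>
  obtain a' b' l where *: "a' \<in> A" "b' \<in> B" "\<forall>x\<in>set a'. d \<le> x" "d \<le> b'"
    and l: "lower_trace d b' = lower_trace d b @ l" "l \<noteq> []" "\<forall>y\<in>set l. \<forall>x\<in>set a'. rho1 x y = rho1 b' y"
    using extend_eq[OF ab] by blast
  have "last (lower_trace d b') \<in> set l" using l by simp
  then have "\<forall>i<length a'. rho1 (a' ! i) (last (lower_trace d b')) \<le> rho1 b' (last (lower_trace d b'))"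
    using l(3) by simp
  then show ?case using * l by (intro bexI[of _ a'] exI[of _ "\<lambda>_. b'"]) auto
next
  case (Suc n)
  then obtain a bs where a: "a \<in> A" "\<And>x. x \<in> set a \<Longrightarrow> d \<le> x"
    and bs: "\<And>m. m \<le> n \<Longrightarrow> bs m \<in> B" "\<And>m. m \<le> n \<Longrightarrow> d \<le> bs m"
      "\<And>m. m \<le> n \<Longrightarrow> lower_trace d (bs m) \<noteq> []"
      "\<And>m. m \<le> n \<Longrightarrow> set (lower_trace d (bs m)) \<subseteq> set (lower_trace d (bs n))"
    and le: "\<And>m i. m \<le> n \<Longrightarrow> i < length a \<Longrightarrow>
      rho1 (a ! i) (last (lower_trace d (bs m))) \<le> rho1 (bs m) (last (lower_trace d (bs m)))"
    and os: "\<And>m i. m \<le> n \<Longrightarrow> i < length a \<Longrightarrow> osc (rho1 (a ! i)) (rho1 (bs m)) (lower_trace d (bs m)) =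
      osc (rho1 (a ! i)) (rho1 (bs 0)) (lower_trace d (bs 0)) + m"
    by blast
  let ?b = "bs n" let ?L = "lower_trace d (bs n)"
  obtain a1 b1 l1 where 1: "a1 \<in> A" "b1 \<in> B" "\<And>x. x \<in> set a1 \<Longrightarrow> d \<le> x" "d \<le> b1"
      "length a1 = length a" "lower_trace d b1 = ?L @ l1" "l1 \<noteq> []"
    and ag1: "\<And>y. y \<in> set ?L \<Longrightarrow> rho1 b1 y = rho1 ?b y"
      "\<And>y i. y \<in> set ?L \<Longrightarrow> i < length a \<Longrightarrow> rho1 (a1 ! i) y = rho1 (a ! i) y"
    and gt1: "\<And>y x. y \<in> set l1 \<Longrightarrow> x \<in> set a1 \<Longrightarrow> rho1 b1 y < rho1 x y"
    using extend_gt[OF a bs(1,2)[OF order_refl]] by blast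
  obtain a2 b2 l2 where 2: "a2 \<in> A" "b2 \<in> B" "\<And>x. x \<in> set a2 \<Longrightarrow> d \<le> x" "d \<le> b2"
      "length a2 = length a1" "lower_trace d b2 = lower_trace d b1 @ l2" "l2 \<noteq> []"
    and ag2: "\<And>y. y \<in> set (lower_trace d b1) \<Longrightarrow> rho1 b2 y = rho1 b1 y"
      "\<And>y i. y \<in> set (lower_trace d b1) \<Longrightarrow> i < length a1 \<Longrightarrow> rho1 (a2 ! i) y = rho1 (a1 ! i) y"
    and eq2: "\<And>y x. y \<in> set l2 \<Longrightarrow> x \<in> set a2 \<Longrightarrow> rho1 x y = rho1 b2 y"
    using extend_eq[OF 1(1,3,2,4)] by blast
  have t2: "lower_trace d b2 = ?L @ l1 @ l2" using 1 2 by simp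
  have agA: "rho1 (a2 ! i) y = rho1 (a ! i) y" if "y \<in> set ?L" "i < length a" for y i
    using ag1(2)[OF that] ag2(2)[of y i] that 1(5,6) by simp
  \<comment> \<open>The traces of the earlier \<open>bs m\<close> are contained in
    \<open>?L\<close>, where the new tuple agrees with the old one, so their counts survive the
    exchange.\<close>
  have keep: "osc (rho1 (a2 ! i)) (rho1 (bs m)) (lower_trace d (bs m)) = osc (rho1 (a ! i)) (rho1 (bs m)) (lower_trace d (bs m))"
    "rho1 (a2 ! i) (last (lower_trace d (bs m))) = rho1 (a ! i) (last (lower_trace d (bs m)))"
    if "m \<le> n" "i < length a" for i m
  proof -
    show "osc (rho1 (a2 ! i)) (rho1 (bs m)) (lower_trace d (bs m)) = osc (rho1 (a ! i)) (rho1 (bs m)) (lower_trace d (bs m))"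
      by (rule osc_cong) (use agA bs(4)[OF that(1)] that(2) in auto)
    show "rho1 (a2 ! i) (last (lower_trace d (bs m))) = rho1 (a ! i) (last (lower_trace d (bs m)))"
      by (rule agA) (use bs(4)[OF that(1)] bs(3)[OF that(1)] that(2) in auto)
  qed
  have new: "osc (rho1 (a2 ! i)) (rho1 b2) (lower_trace d b2) = osc (rho1 (a ! i)) (rho1 ?b) ?L + 1"
    "rho1 (a2 ! i) (last (lower_trace d b2)) = rho1 b2 (last (lower_trace d b2))"
    if i: "i < length a" for i
  proof -
    let ?s = "rho1 (a2 ! i)" let ?t = "rho1 b2"
    have L: "?s y = rho1 (a ! i) y" "?t y = rho1 ?b y" if "y \<in> set ?L" for y
      using agA[OF that i] ag1(1)[OF that] ag2(1)[of y] that 1(6) by auto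
    have l1: "?t y < ?s y" if "y \<in> set l1" for y
      using gt1[OF that, of "a1 ! i"] ag2(1)[of y] ag2(2)[of y i] that i 1(5,6) by simp
    have l2: "?s y = ?t y" if "y \<in> set l2" for y
      using eq2[OF that, of "a2 ! i"] i 1(5) 2(5) by simp
    have ne: "?L \<noteq> []" using bs(3) by simp
    have lastL: "last ?L \<in> set ?L" using ne by simp
    \<comment> \<open>Between \<open>l1\<close> and \<open>l2\<close> the change is from
      \<open>t < s\<close> to equality, which is not counted. The one new crossing sits where
      \<open>?L\<close> meets \<open>l1\<close>.\<close>
    have "osc ?s ?t (l1 @ l2) = 0"
      using osc_append[OF 1(7) 2(7), of ?s ?t] osc_less[of l1 ?t ?s] osc_le[of l2 ?s ?t] l1 l2
        2(7) l1[of "last l1"] 1(7) by simp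
    moreover have "?s (last ?L) \<le> ?t (last ?L)" using L[OF lastL] le[OF order_refl i] by simp
    moreover have "?t (hd (l1 @ l2)) < ?s (hd (l1 @ l2))" using l1 1(7) by simp
    moreover have "osc ?s ?t ?L = osc (rho1 (a ! i)) (rho1 ?b) ?L" by (rule osc_cong) (use L in auto)
    ultimately show "osc ?s ?t (lower_trace d b2) = osc (rho1 (a ! i)) (rho1 ?b) ?L + 1"
      using osc_append[OF ne, of "l1 @ l2" ?s ?t] 1(7) unfolding t2 by simp
    show "?s (last (lower_trace d b2)) = ?t (last (lower_trace d b2))"
      unfolding 2(6) using 2(7) l2 by simp
  qed
  let ?bs = "bs(Suc n := b2)"
  have "?bs m \<in> B \<and> d \<le> ?bs m \<and> lower_trace d (?bs m) \<noteq> []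
    \<and> set (lower_trace d (?bs m)) \<subseteq> set (lower_trace d (?bs (Suc n)))
    \<and> (\<forall>i<length a2. rho1 (a2 ! i) (last (lower_trace d (?bs m))) \<le> rho1 (?bs m) (last (lower_trace d (?bs m)))
       \<and> osc (rho1 (a2 ! i)) (rho1 (?bs m)) (lower_trace d (?bs m)) = osc (rho1 (a2 ! i)) (rho1 (?bs 0)) (lower_trace d (?bs 0)) + m)"
    if "m \<le> Suc n" for m
  proof (cases "m = Suc n")
    case True
    then show ?thesis
      using 2(2,4,5,7) 1(5) new os[of n] keep(1)[of 0] t2 by auto
  next
    case False
    then have "m \<le> n" using that by simp
    then show ?thesis
      using bs[of m] le[of m] os[of m] keep[of m] keep(1)[of 0] 2(5) 1(5) t2 False by auto
  qed
  then show ?case using 2(1,3) by (intro bexI[of _ a2] exI[of _ ?bs]) auto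
qed

lemma oscillation:
  assumes "large A" "unbounded B"
  shows "\<exists>a\<in>A. \<exists>bs. \<forall>m\<le>n. bs m \<in> B \<and> (\<forall>x\<in>set a. x < bs m \<and> osc_number x (bs m) = osc_number x (bs 0) + m)"
proof -
  obtain a bs where a: "a \<in> A" "\<And>x. x \<in> set a \<Longrightarrow> d \<le> x"
    and bs: "\<And>m. m \<le> n \<Longrightarrow> bs m \<in> B" "\<And>m. m \<le> n \<Longrightarrow> d \<le> bs m"
      "\<And>m. m \<le> n \<Longrightarrow> lower_trace d (bs m) \<noteq> []"
      "\<And>m. m \<le> n \<Longrightarrow> set (lower_trace d (bs m)) \<subseteq> set (lower_trace d (bs n))"
    and le: "\<And>m i. m \<le> n \<Longrightarrow> i < length a \<Longrightarrow>
      rho1 (a ! i) (last (lower_trace d (bs m))) \<le> rho1 (bs m) (last (lower_trace d (bs m)))"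
    and os: "\<And>m i. m \<le> n \<Longrightarrow> i < length a \<Longrightarrow> osc (rho1 (a ! i)) (rho1 (bs m)) (lower_trace d (bs m)) =
      osc (rho1 (a ! i)) (rho1 (bs 0)) (lower_trace d (bs 0)) + m"
    using chain[OF assms, of n] by blast
  obtain c where c: "c < d" "\<And>y. y \<in> set (lower_trace d (bs n)) \<Longrightarrow> y < c"
    and ag: "\<And>x y. x \<in> bs ` {..n} \<Longrightarrow> c \<le> y \<Longrightarrow> y < d \<Longrightarrow> rho1 x y = rho1 d y"
    using agreement[of "bs ` {..n}" "set (lower_trace d (bs n))"] bs(2) lower_trace_less by blast
  obtain v where v: "v < d" "\<And>x y. v < x \<Longrightarrow> x < d \<Longrightarrow> y \<in> set (lower_trace x d) \<Longrightarrow> c \<le> y"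
    using lower_trace_tail[OF c(1)] by blast
  txt \<open>Reflecting the tuple to one just below \<open>d\<close> appends to all the traces the same final block,
    on which all the functions \<open>rho1 (bs m)\<close> coincide with \<open>rho1 d\<close>.\<close>
  let ?A = "of_type A c (type_at c a)"
  let ?S = "{x. \<not> (\<exists>a\<in>?A. \<forall>y\<in>set a. v < y \<and> y \<le> x)}"
  \<comment> \<open>A single tuple above \<open>v\<close> bounds \<open>?S\<close>; by reflection
    the bound drops below \<open>d\<close>, so that some tuple fits between \<open>v\<close> and
    \<open>d\<close>.\<close>
  obtain a1 where a1: "a1 \<in> ?A" "\<And>x. x \<in> set a1 \<Longrightarrow> v < x"
    using large_of_type[OF a c(1)] unfolding large_def by blast
  obtain u where u: "\<And>x. x \<in> set a1 \<Longrightarrow> x < u"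
    using bounded_if_countable_omega1[of "set a1"] by (auto simp: countable_finite)
  have "x < u" if "x \<in> ?S" for x
    using that a1 u by (smt (verit) less_imp_le mem_Collect_eq not_less order_trans)
  then have "\<not> unbounded ?S" unfolding not_unbounded by blast
  moreover have "reflects d ?S"
    by (intro between c(1) v(1) type_at_in_types_at) (use a c in \<open>meson less_imp_le order_trans\<close>)
  ultimately obtain w where "w < d" "w \<notin> ?S" unfolding reflects_def by blast
  then obtain a' where a': "a' \<in> ?A" "\<And>x. x \<in> set a' \<Longrightarrow> v < x" "\<And>x. x \<in> set a' \<Longrightarrow> x < d"
    by (smt (verit) le_less_trans mem_Collect_eq)
  have t: "type_at c a' = type_at c a" "a' \<in> A" using a'(1) by (auto simp: of_type_def)
  have "bs m \<in> B \<and> (\<forall>x\<in>set a'. x < bs m \<and> osc_number x (bs m) = osc_number x (bs 0) + m)" if m: "m \<le> n" for m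
  proof (intro conjI ballI)
    show "bs m \<in> B" using bs(1)[OF m] .
    fix x assume x: "x \<in> set a'"
    then obtain i where i: "i < length a'" "x = a' ! i" by (metis in_set_conv_nth)
    have i': "i < length a" using i(1) type_at_length[OF t(1)] by simp
    have xd: "bot_omega1 < x" "x < d" using a'(2,3)[OF x] le_less_trans bot_omega1_le by blast+
    then show "x < bs m" using bs(2)[OF m] by simp
    let ?l = "lower_trace x d"
    have lne: "?l \<noteq> []" using lower_trace_ne xd by blast
    have l: "c \<le> y" "y < d" if "y \<in> set ?l" for y
      using v(2)[OF a'(2,3)[OF x] that] lower_trace_less[OF that] xd by auto
    \<comment> \<open>The crossing at the junction with \<open>?l\<close>. It is the same for all
      \<open>k\<close>: the preceding entry satisfies \<open>\<le>\<close> for every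
      \<open>bs k\<close>, and on \<open>?l\<close> each \<open>rho1 (bs k)\<close> is
      \<open>rho1 d\<close>.\<close>
    let ?j = "if rho1 d (hd ?l) < rho1 x (hd ?l) then 1 else 0"
    have key: "osc_number x (bs k) = osc (rho1 (a ! i)) (rho1 (bs k)) (lower_trace d (bs k)) + osc (rho1 x) (rho1 d) ?l + ?j"
      if k: "k \<le> n" for k
    proof -
      have below: "y < c" if "y \<in> set (lower_trace d (bs k))" for y
        using bs(4)[OF k] c(2) that by auto
      have app: "lower_trace x (bs k) = lower_trace d (bs k) @ ?l"
        using xd bs(2)[OF k] below l(1) by (intro lower_trace_append) (auto intro: less_le_trans)
      have ea: "rho1 x y = rho1 (a ! i) y" if "y \<in> set (lower_trace d (bs k))" for y
        using type_atD[OF t(1) i(1)] below[OF that] i(2) by simp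
      have eb: "rho1 (bs k) y = rho1 d y" if "y \<in> set ?l" for y
        using ag l[OF that] k by simp
      have ll: "last (lower_trace d (bs k)) \<in> set (lower_trace d (bs k))" using bs(3)[OF k] by simp
      have "osc (rho1 x) (rho1 (bs k)) (lower_trace d (bs k)) = osc (rho1 (a ! i)) (rho1 (bs k)) (lower_trace d (bs k))"
        by (rule osc_cong) (use ea in auto)
      moreover have "osc (rho1 x) (rho1 (bs k)) ?l = osc (rho1 x) (rho1 d) ?l"
        by (rule osc_cong) (use eb in auto)
      moreover have "rho1 x (last (lower_trace d (bs k))) \<le> rho1 (bs k) (last (lower_trace d (bs k)))"
        using ea[OF ll] le[OF k i'] by simp
      moreover have "rho1 (bs k) (hd ?l) = rho1 d (hd ?l)" using eb lne by simp
      ultimately show ?thesis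
        unfolding osc_number_def app using osc_append[OF bs(3)[OF k] lne, of "rho1 x" "rho1 (bs k)"] by simp
    qed
    show "osc_number x (bs m) = osc_number x (bs 0) + m"
      using key[OF m] key[of 0] os[OF m i'] by simp
  qed
  then show ?thesis using t(2) by blast
qed

end

theorem osc_number_oscillates:
  assumes "large A" "unbounded B"
  shows "\<exists>a\<in>A. \<exists>bs. \<forall>m\<le>n. bs m \<in> B \<and> (\<forall>x\<in>set a. x < bs m \<and> osc_number x (bs m) = osc_number x (bs 0) + m)"
  using reflecting.oscillation[OF _ assms] reflecting_ex by blast

section \<open>Kronecker approximation\<close>

text \<open>A Hamel basis containing 1; a countable one would span only countably many
  reals.\<close>

lemma uncountable_rat_independent:
  "\<exists>S. 1 \<in> S \<and> uncountable S \<and> module.independent (\<lambda>q::rat. (*) (of_rat q :: real)) S"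
proof -
  interpret vector_space "\<lambda>q::rat. (*) (of_rat q :: real)"
    by unfold_locales (auto simp: of_rat_add of_rat_mult algebra_simps)
  have ind: "independent {1}" by simp
  define S where "S = extend_basis {1}"
  have S: "1 \<in> S" "independent S" "span S = UNIV"
    using extend_basis_superset[OF ind] independent_extend_basis[OF ind] span_extend_basis[OF ind]
    by (auto simp: S_def)
  have "uncountable S"
  proof
    assume "countable S"
    let ?g = "\<lambda>F. \<Sum>(a, q)\<in>F. (of_rat q :: real) * a"
    have "span S \<subseteq> ?g ` {F. finite F \<and> F \<subseteq> S \<times> UNIV}"
    proof
      fix x assume "x \<in> span S"
      then obtain t r where t: "finite t" "t \<subseteq> S" "x = (\<Sum>a\<in>t. of_rat (r a) * a)"
        unfolding span_explicit by blast
      have "x = ?g ((\<lambda>a. (a, r a)) ` t)"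
        unfolding t(3) by (subst sum.reindex) (auto simp: inj_on_def)
      then show "x \<in> ?g ` {F. finite F \<and> F \<subseteq> S \<times> UNIV}" using t by blast
    qed
    moreover have "countable {F. finite F \<and> F \<subseteq> S \<times> (UNIV :: rat set)}"
      using \<open>countable S\<close> by (intro countable_Collect_finite_subset) simp
    ultimately have "countable (span S)"
      using countable_image countable_subset by blast
    then have "countable (UNIV :: real set)" using S(3) by simp
    then show False using uncountable_UNIV_real by simp
  qed
  with S show ?thesis by blast
qed

lemma int_independent_if_rat_independent:
  assumes "module.independent (\<lambda>q::rat. (*) (of_rat q :: real)) S"
  shows "module.independent (\<lambda>r::int. (*) (of_int r :: real)) S"
proof -
  interpret Q: vector_space "\<lambda>q::rat. (*) (of_rat q :: real)"
    by unfold_locales (auto simp: of_rat_add of_rat_mult algebra_simps)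
  interpret Z: module "\<lambda>r::int. (*) (of_int r :: real)"
    by (simp add: Modules.module.intro distrib_left mult.commute)
  show ?thesis unfolding Z.independent_explicit_module
  proof (intro allI impI)
    fix t :: "real set" and u :: "real \<Rightarrow> int" and v
    assume t: "finite t" "t \<subseteq> S" "(\<Sum>v\<in>t. real_of_int (u v) * v) = 0" "v \<in> t"
    then have "(\<Sum>v\<in>t. of_rat (rat_of_int (u v)) * v) = 0" by simp
    then have "rat_of_int (u v) = 0" 
      using Q.independentD[where u = "\<lambda>v. rat_of_int (u v)", OF assms t(1,2) _ t(4)] by simp
    then show "u v = 0" by simp
  qed
qed

lemma independent_omega1:
  "\<exists>freq :: omega1 \<Rightarrow> real. inj freq \<and> 1 \<notin> range freq \<and>
     module.independent (\<lambda>r::int. (*) (of_int r :: real)) (insert 1 (range freq))"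
proof -
  interpret Z: module "\<lambda>r::int. (*) (of_int r :: real)"
    by (simp add: Modules.module.intro distrib_left mult.commute)
  obtain S where S: "1 \<in> S" "uncountable S" "module.independent (\<lambda>q::rat. (*) (of_rat q :: real)) S"
    using uncountable_rat_independent by blast
  define P where "P f x r \<longleftrightarrow> r \<in> S \<and> r \<noteq> 1 \<and> r \<notin> f ` {..<x}" for f and x :: omega1 and r :: real
  have "\<exists>f. \<forall>x :: omega1. P f x (f x)"
  proof (rule dependent_wellorder_choice)
    fix r and f g :: "omega1 \<Rightarrow> real" and x
    assume "\<And>z. z < x \<Longrightarrow> f z = g z"
    then have "f ` {..<x} = g ` {..<x}" by (auto simp: image_def)
    then show "P f x r = P g x r" by (simp add: P_def)
  next
    fix x and f :: "omega1 \<Rightarrow> real"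
    have "countable (insert 1 (f ` {..<x}))" using countable_lessThan_omega1 by simp
    then have "S - insert 1 (f ` {..<x}) \<noteq> {}"
      using S(2) by (metis Diff_eq_empty_iff countable_subset)
    then show "\<exists>r. P f x r" unfolding P_def by blast
  qed
  then obtain freq where freq: "\<And>x. freq x \<in> S" "\<And>x. freq x \<noteq> 1" "\<And>x y. y < x \<Longrightarrow> freq x \<noteq> freq (y :: omega1)"
    unfolding P_def by blast
  have "inj freq" by (rule linorder_injI) (use freq(3) in metis)
  moreover have "module.independent (\<lambda>r::int. (*) (of_int r :: real)) (insert 1 (range freq))"
    by (rule Z.independent_mono[OF int_independent_if_rat_independent[OF S(3)]]) (use freq S in auto)
  ultimately show ?thesis using freq(2) by force
qed

definition freq :: "omega1 \<Rightarrow> real" where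
  "freq = (SOME freq. inj freq \<and> 1 \<notin> range freq \<and>
     module.independent (\<lambda>r::int. (*) (of_int r :: real)) (insert 1 (range freq)))"

lemma freq: "inj freq" "1 \<notin> range freq"
  "module.independent (\<lambda>r::int. (*) (of_int r :: real)) (insert 1 (range freq))"
  using someI_ex[OF independent_omega1] unfolding freq_def by blast+

lemma freq_irrational:
  assumes "of_int p * freq x = of_int q"
  shows "p = 0"
proof -
  interpret Z: module "\<lambda>r::int. (*) (of_int r :: real)"
    by (simp add: Modules.module.intro distrib_left mult.commute)
  have ne: "freq x \<noteq> 1" using freq(2) by auto
  let ?u = "(\<lambda>_. 0 :: int)(freq x := p, 1 := - q)"
  have "?u (freq x) = 0"
    by (rule Z.independentD[OF freq(3), of "{1, freq x}"]) (use ne assms in auto)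
  then show ?thesis using ne by simp
qed

text \<open>The bound \<open>N\<close> may not depend on the shift \<open>c\<close>, which will come
  from the first oscillation number and is known only after the length of the oscillation has been
  fixed. As \<open>c\<close> matters only modulo 1, rounding it to multiples of \<open>1 / M\<close>
  leaves finitely many cases \<open>J\<close>.\<close>

lemma uniform_kronecker:
  fixes v :: "nat \<Rightarrow> real"
  assumes a: "distinct a" and e: "e > 0"
  shows "\<exists>N. \<forall>c :: nat \<Rightarrow> real. \<exists>m\<le>N. \<forall>i<length a. \<exists>h :: int. \<bar>c i + real m * freq (a ! i) - h - v i\<bar> < e"
proof -
  interpret Z: module "\<lambda>r::int. (*) (of_int r :: real)"
    by (simp add: Modules.module.intro distrib_left mult.commute)
  let ?k = "length a"
  define t where "t i = (if i < ?k then freq (a ! i) else 1)" for i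
  have "t ` {..?k} \<subseteq> insert 1 (range freq)" by (auto simp: t_def)
  then have ind: "Z.independent (t ` {..?k})" by (rule Z.independent_mono[OF freq(3)])
  have inj: "inj_on t {..?k}"
  proof (rule inj_onI)
    fix i j assume "i \<in> {..?k}" "j \<in> {..?k}" "t i = t j"
    then show "i = j"
      using freq(2) injD[OF freq(1), of "a ! i" "a ! j"] nth_eq_iff_index_eq[OF a, of i j]
      by (cases "i < ?k"; cases "j < ?k") (auto simp: t_def)
  qed
  obtain M :: nat where M: "1 / real M < e / 2" "M > 0"
    using e by (metis half_gt_zero inverse_eq_divide reals_Archimedean gr0_conv_Suc)
  have "\<exists>K::int. \<forall>i<?k. \<exists>h::int. \<bar>of_int K * freq (a ! i) - h - (v i - real (j i) / M)\<bar> < e / 2" for j :: "nat \<Rightarrow> nat"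
  proof -
    obtain K m where "\<And>i. i < ?k \<Longrightarrow> \<bar>of_int K * t i - of_int (m i) - (v i - real (j i) / M)\<bar> < e / 2"
      using Kronecker_thm_2[OF ind inj, of "e / 2" "\<lambda>i. v i - real (j i) / M"] e by (auto simp: t_def)
    then show ?thesis unfolding t_def by (intro exI[of _ K]) auto
  qed
  then obtain K :: "(nat \<Rightarrow> nat) \<Rightarrow> int" where
    K: "\<And>j i. i < ?k \<Longrightarrow> \<exists>h::int. \<bar>of_int (K j) * freq (a ! i) - h - (v i - real (j i) / M)\<bar> < e / 2"
    by metis
  define J where "J = PiE {..<?k} (\<lambda>_. {..M})"
  have "finite J" unfolding J_def by (intro finite_PiE) auto
  define N where "N = Max (insert 0 ((\<lambda>j. \<bar>K j\<bar>) ` J))"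
  have N: "\<bar>K j\<bar> \<le> N" if "j \<in> J" for j
    unfolding N_def using \<open>finite J\<close> that by (intro Max_ge) auto
  have "N \<ge> 0" unfolding N_def using \<open>finite J\<close> by (intro Max_ge) auto
  show ?thesis
  proof (rule exI[of _ "nat (2 * N)"], rule allI)
    fix c :: "nat \<Rightarrow> real"
    \<comment> \<open>Shifting by \<open>N\<close> in advance compensates for negative
      \<open>K j\<close>: the multiplier \<open>N + K j\<close> lies between 0 and
      \<open>2 * N\<close>.\<close>
    define c' where "c' i = c i + N * freq (a ! i)" for i
    define j where "j = restrict (\<lambda>i. nat \<lfloor>frac (c' i) * M\<rfloor>) {..<?k}"
    have j: "real (j i) \<le> frac (c' i) * M" "frac (c' i) * M < real (j i) + 1" if "i < ?k" for i
      using that M(2) by (auto simp: j_def)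
    have "j i \<le> M" if "i < ?k" for i
    proof -
      have "frac (c' i) * real M \<le> 1 * real M"
        using frac_lt_1[of "c' i"] by (intro mult_right_mono) auto
      then show ?thesis using j(1)[OF that] by linarith
    qed
    then have "j \<in> J" unfolding J_def by (auto simp: j_def)
    define m where "m = nat (N + K j)"
    have m: "real m = N + K j" using N[OF \<open>j \<in> J\<close>] unfolding m_def by simp
    have "m \<le> nat (2 * N)" using N[OF \<open>j \<in> J\<close>] unfolding m_def by simp
    moreover have "\<exists>h :: int. \<bar>c i + real m * freq (a ! i) - h - v i\<bar> < e" if i: "i < ?k" for i
    proof -
      obtain h :: int where h: "\<bar>of_int (K j) * freq (a ! i) - h - (v i - real (j i) / M)\<bar> < e / 2"
        using K[OF i] by blast
      have "real (j i) / M \<le> frac (c' i)" "frac (c' i) < real (j i) / M + 1 / M"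
        using j[OF i] M(2) by (auto simp: field_simps)
      then have f: "\<bar>frac (c' i) - real (j i) / M\<bar> < e / 2" using M(1) by linarith
      have "c i + real m * freq (a ! i) - (h + \<lfloor>c' i\<rfloor>) - v i =
         (of_int (K j) * freq (a ! i) - h - (v i - real (j i) / M)) + (frac (c' i) - real (j i) / M)"
        unfolding m c'_def frac_def by (simp add: algebra_simps)
      then have "\<bar>c i + real m * freq (a ! i) - (h + \<lfloor>c' i\<rfloor>) - v i\<bar> < e"
        using h f by linarith
      then show ?thesis by (metis of_int_add)
    qed
    ultimately show "\<exists>m\<le>nat (2 * N). \<forall>i<?k. \<exists>h :: int. \<bar>c i + real m * freq (a ! i) - h - v i\<bar> < e"
      by blast
  qed
qed

text \<open>The real parts of the coordinates of the points of Moore's L-space.\<close>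

definition wave :: "omega1 \<Rightarrow> omega1 \<Rightarrow> real" where
  "wave b x = (if x < b then cos (2 * pi * (freq x * (real (osc_number x b) + 1))) else 1)"

lemma abs_ww_le: "\<bar>wave b x\<bar> \<le> 1"
  unfolding wave_def by (simp add: abs_le_iff minus_le_iff)

lemma wave_eq_1: "b \<le> x \<Longrightarrow> wave b x = 1"
  unfolding wave_def by simp

text \<open>The summand 1 in \<open>wave\<close> makes the multiple of the irrational
  \<open>freq x\<close> a non-zero one, even when the oscillation number is 0.\<close>

lemma wave_ne_1: "x < b \<Longrightarrow> wave b x \<noteq> 1"
proof
  assume "x < b" "wave b x = 1"
  then have "cos (2 * pi * (freq x * (real (osc_number x b) + 1))) = 1" by (simp add: wave_def)
  then obtain n :: int where "2 * pi * (freq x * (real (osc_number x b) + 1)) = of_int n * 2 * pi"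
    using cos_one_2pi_int by blast
  then have "freq x * (real (osc_number x b) + 1) = of_int n" by simp
  then have "of_int (int (osc_number x b) + 1) * freq x = of_int n" by (simp add: algebra_simps)
  then show False using freq_irrational by (metis nat_int_comparison(1) of_nat_Suc Suc_neq_Zero semiring_1_class.of_nat_0 add.commute)
qed

lemma wave_ne_m1: "wave b x \<noteq> - 1"
proof
  assume m: "wave b x = - 1"
  then have "x < b" unfolding wave_def by (auto split: if_splits)
  let ?y = "2 * pi * (freq x * (real (osc_number x b) + 1))"
  have "cos ?y = - 1" using m \<open>x < b\<close> by (simp add: wave_def)
  then have "cos (2 * ?y) = 1" unfolding cos_double_cos by simp
  then obtain n :: int where "2 * ?y = of_int n * 2 * pi" using cos_one_2pi_int by blast
  then have "2 * (freq x * (real (osc_number x b) + 1)) = of_int n" by simp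
  then have "of_int (2 * (int (osc_number x b) + 1)) * freq x = of_int n" by (simp add: algebra_simps)
  then have "2 * (int (osc_number x b) + 1) = 0" by (rule freq_irrational)
  then show False by simp
qed

lemma abs_cos_diff_le: "\<bar>cos x - cos y\<bar> \<le> \<bar>x - y :: real\<bar>"
proof -
  have "\<bar>cos x - cos y\<bar> = 2 * (\<bar>sin ((x + y) / 2)\<bar> * \<bar>sin ((y - x) / 2)\<bar>)"
    unfolding cos_diff_cos by (simp add: abs_mult)
  also have "\<dots> \<le> 2 * (1 * \<bar>(y - x) / 2\<bar>)"
    by (intro mult_left_mono mult_mono abs_sin_le_one abs_sin_x_le_abs_x) auto
  also have "\<dots> = \<bar>x - y\<bar>" by simp
  finally show ?thesis .
qed

text \<open>Countably many bounds have a common upper bound.\<close>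

lemma large_UN:
  fixes A :: "'i :: countable \<Rightarrow> omega1 list set"
  assumes "large (\<Union>i. A i)"
  shows "\<exists>i. large (A i)"
proof (rule ccontr)
  assume "\<nexists>i. large (A i)"
  then obtain z where z: "\<And>i a. a \<in> A i \<Longrightarrow> \<exists>x\<in>set a. x \<le> z i"
    unfolding large_def by (metis not_less)
  obtain u where u: "\<And>i. z i < u" using bounded_if_countable_omega1[of "range z"] by auto
  obtain i a where a: "a \<in> A i" "\<And>x. x \<in> set a \<Longrightarrow> u < x"
    using assms unfolding large_def by (metis UN_E)
  obtain x where "x \<in> set a" "x \<le> z i" using z[OF a(1)] by blast
  with a(2)[of x] u[of i] show False by simp
qed

lemma unbounded_thin:
  fixes f :: "omega1 \<Rightarrow> 'c :: countable"
  assumes "unbounded C"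
  shows "\<exists>c. unbounded {b \<in> C. f b = c}"
proof (rule ccontr)
  assume "\<nexists>c. unbounded {b \<in> C. f b = c}"
  then obtain z where z: "\<And>c b. b \<in> C \<Longrightarrow> f b = c \<Longrightarrow> b < z c"
    unfolding not_unbounded not_ex by (simp add: not_unbounded) metis
  obtain u where u: "\<And>c. z c < u" using bounded_if_countable_omega1[of "range z"] by auto
  obtain b where "b \<in> C" "u < b" using assms unfolding unbounded_def by blast
  with z[of b "f b"] u[of "f b"] show False by auto
qed

text \<open>The Kronecker bound \<open>N a\<close> depends on the tuple, whereas the length of the
  oscillation is fixed before a tuple is found; hence the passage to a large subfamily with constant
  bound \<open>n\<close>. One of \<open>b_0, ..., b_n\<close> then has the right phase in all
  coordinates at once.\<close>

theorem wave_dense: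
  fixes v :: "nat \<Rightarrow> real"
  assumes A: "large A" "\<And>a. a \<in> A \<Longrightarrow> distinct a \<and> length a = k"
    and B: "unbounded B" and v: "\<And>i. i < k \<Longrightarrow> \<bar>v i\<bar> \<le> 1" and e: "e > 0"
  shows "\<exists>a\<in>A. \<exists>b\<in>B. \<forall>i<k. a ! i < b \<and> \<bar>wave b (a ! i) - v i\<bar> < e"
proof -
  \<comment> \<open>\<open>u i\<close> is a phase with cosine \<open>v i\<close>, in full turns; the
    factor \<open>2 * pi\<close> in the tolerance is the Lipschitz constant of the wave in that
    unit.\<close>
  define u where "u i = arccos (v i) / (2 * pi)" for i
  define e' where "e' = e / (2 * pi)"
  have e': "e' > 0" using e by (simp add: e'_def)
  have u: "cos (2 * pi * u i) = v i" if "i < k" for i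
    using v[OF that] by (simp add: u_def abs_le_iff minus_le_iff)
  have "\<forall>a\<in>A. \<exists>N. \<forall>c :: nat \<Rightarrow> real. \<exists>m\<le>N. \<forall>i<k. \<exists>h :: int. \<bar>c i + real m * freq (a ! i) - h - u i\<bar> < e'"
    using uniform_kronecker[OF _ e', of _ u] A(2) by blast
  then obtain N where N: "\<And>a c. a \<in> A \<Longrightarrow>
    \<exists>m\<le>N a. \<forall>i<k. \<exists>h :: int. \<bar>c i + real m * freq (a ! i) - h - u i\<bar> < e'"
    by metis
  have "A = (\<Union>n. {a \<in> A. N a = n})" by auto
  then obtain n where n: "large {a \<in> A. N a = n}"
    using large_UN[of "\<lambda>n. {a \<in> A. N a = n}"] A(1) by auto
  obtain a bs where a: "a \<in> A" "N a = n" and bs: "\<And>m. m \<le> n \<Longrightarrow> bs m \<in> B"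
    and os: "\<And>m x. m \<le> n \<Longrightarrow> x \<in> set a \<Longrightarrow> x < bs m \<and> osc_number x (bs m) = osc_number x (bs 0) + m"
    using osc_number_oscillates[OF n B, of n] by blast
  obtain m where m: "m \<le> n" and
    close: "\<And>i. i < k \<Longrightarrow> \<exists>h :: int. \<bar>freq (a ! i) * (real (osc_number (a ! i) (bs 0)) + 1) + real m * freq (a ! i) - h - u i\<bar> < e'"
    using N[OF a(1), of "\<lambda>i. freq (a ! i) * (real (osc_number (a ! i) (bs 0)) + 1)"] a(2) by blast
  have "a ! i < bs m \<and> \<bar>wave (bs m) (a ! i) - v i\<bar> < e" if i: "i < k" for i
  proof -
    have x: "a ! i \<in> set a" using A(2)[OF a(1)] i by auto
    let ?t = "freq (a ! i) * (real (osc_number (a ! i) (bs m)) + 1)"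
    obtain h :: int where "\<bar>?t - h - u i\<bar> < e'"
      using close[OF i] os[OF m x] by (auto simp: algebra_simps)
    then have "2 * pi * \<bar>?t - h - u i\<bar> < e" by (simp add: e'_def field_simps)
    have "cos (2 * pi * ?t) = cos (2 * pi * ?t - 2 * pi * h)"
      using cos_add[of "2 * pi * ?t - 2 * pi * h" "2 * pi * h"] by simp
    then have "\<bar>wave (bs m) (a ! i) - v i\<bar> = \<bar>cos (2 * pi * ?t - 2 * pi * h) - cos (2 * pi * u i)\<bar>"
      using os[OF m x] u[OF i] by (simp add: wave_def)
    also have "\<dots> \<le> \<bar>2 * pi * ?t - 2 * pi * h - 2 * pi * u i\<bar>" by (rule abs_cos_diff_le)
    also have "\<dots> = \<bar>(2 * pi) * (?t - h - u i)\<bar>" by (simp add: algebra_simps)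
    also have "\<dots> = 2 * pi * \<bar>?t - h - u i\<bar>" by (subst abs_mult) simp
    also have "\<dots> < e" by fact
    finally show ?thesis using os[OF m x] by simp
  qed
  then show ?thesis using a(1) bs[OF m] by blast
qed

section \<open>The space\<close>

text \<open>If no \<open>d\<close> worked, counterexamples would form a large family. Countably many
  classes by precision and length leave one large class, which contradicts
  \<open>wave_dense\<close>.\<close>

lemma wave_near_m1:
  assumes B: "unbounded B"
  obtains d where "\<And>F e. \<lbrakk>finite F; \<forall>x\<in>F. d < x; e > 0\<rbrakk> \<Longrightarrow>
    \<exists>b\<in>B. \<forall>x\<in>F. x < b \<and> \<bar>wave b x - (-1)\<bar> < e"
proof (rule ccontr)
  assume "\<not> thesis"
  then have neg: "\<exists>F e. finite F \<and> (\<forall>x\<in>F. d < x) \<and> e > 0 \<and>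
      \<not> (\<exists>b\<in>B. \<forall>x\<in>F. x < b \<and> \<bar>wave b x - (-1)\<bar> < e)" for d
    using that[of d] by blast
  define bad where "bad = (\<lambda>(n, k). {a. distinct a \<and> length a = k \<and>
     \<not> (\<exists>b\<in>B. \<forall>x\<in>set a. x < b \<and> \<bar>wave b x - (-1)\<bar> < 1 / real (Suc n))})"
  have "large (\<Union>p. bad p)" unfolding large_def
  proof
    fix d
    obtain F e where F: "finite F" "\<forall>x\<in>F. d < x" "e > 0"
      "\<not> (\<exists>b\<in>B. \<forall>x\<in>F. x < b \<and> \<bar>wave b x - (-1)\<bar> < e)"
      using neg[of d] by blast
    obtain n where "1 / real (Suc n) < e"
      using reals_Archimedean[OF F(3)] by (auto simp: inverse_eq_divide)
    then have "\<not> (\<exists>b\<in>B. \<forall>x\<in>F. x < b \<and> \<bar>wave b x - (-1)\<bar> < 1 / real (Suc n))"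
      using F(4) less_trans by blast
    moreover obtain a where "set a = F" "distinct a"
      using finite_distinct_list[OF F(1)] by blast
    ultimately have "a \<in> bad (n, length a)" unfolding bad_def by simp
    then show "\<exists>a\<in>\<Union>p. bad p. \<forall>x\<in>set a. d < x" using F(2) \<open>set a = F\<close> by blast
  qed
  then obtain p where "large (bad p)" using large_UN by blast
  moreover obtain n k where p: "p = (n, k)" by fastforce
  ultimately have "\<exists>a\<in>bad p. \<exists>b\<in>B. \<forall>i<k. a ! i < b \<and> \<bar>wave b (a ! i) - (-1)\<bar> < 1 / real (Suc n)"
    by (intro wave_dense B) (auto simp: bad_def)
  then obtain a b where a: "a \<in> bad p" and b: "b \<in> B"
    "\<And>i. i < k \<Longrightarrow> a ! i < b \<and> \<bar>wave b (a ! i) - (-1)\<bar> < 1 / real (Suc n)" by blast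
  have "length a = k" using a p by (simp add: bad_def)
  then have "\<forall>x\<in>set a. x < b \<and> \<bar>wave b x - (-1)\<bar> < 1 / real (Suc n)"
    using b(2) by (metis in_set_conv_nth)
  then show False using a b(1) p unfolding bad_def by auto
qed

text \<open>A substitute for the \<open>\<Delta>\<close>-system lemma.\<close>

lemma maximal_root:
  assumes C: "unbounded C" and F: "\<And>b. b \<in> C \<Longrightarrow> finite (F b) \<and> card (F b) = k"
  shows "\<exists>r. unbounded {b \<in> C. r \<subseteq> F b} \<and> (\<forall>x. x \<notin> r \<longrightarrow> \<not> unbounded {b \<in> C. insert x r \<subseteq> F b})"
proof -
  let ?P = "\<lambda>r. unbounded {b \<in> C. r \<subseteq> F b}"
  have fin: "finite r \<and> card r \<le> k" if r: "?P r" for r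
  proof -
    obtain b where "b \<in> C" "r \<subseteq> F b" using r unfolding unbounded_def by blast
    then show ?thesis using F card_mono finite_subset by metis
  qed
  have "?P {}" using C by simp
  then obtain r where r: "?P r" "\<And>r'. ?P r' \<Longrightarrow> card r' \<le> card r"
    using ex_has_greatest_nat[of ?P "{}" card "Suc k"] fin by (auto simp: less_Suc_eq_le)
  have "\<not> ?P (insert x r)" if "x \<notin> r" for x
    using r(2)[of "insert x r"] fin[OF r(1)] that by auto
  then show ?thesis using r(1) by blast
qed

lemma floor_eq_imp_close:
  fixes x y :: real
  assumes "\<lfloor>x * 2 * real (Suc n)\<rfloor> = \<lfloor>y * 2 * real (Suc n)\<rfloor>"
  shows "\<bar>x - y\<bar> < 1 / (2 * real (Suc n))"
proof -
  have "\<bar>x * 2 * real (Suc n) - y * 2 * real (Suc n)\<bar> < 1" using assms by linarith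
  moreover have "x * 2 * real (Suc n) - y * 2 * real (Suc n) = (x - y) * (2 * real (Suc n))"
    by (simp add: algebra_simps)
  ultimately have "\<bar>x - y\<bar> * (2 * real (Suc n)) < 1"
    by (simp only: abs_mult abs_of_nat abs_numeral)
  then show ?thesis by (subst pos_less_divide_eq) simp_all
qed

text \<open>\<open>F b\<close> and \<open>n b\<close> describe a basic neighbourhood of the point
  with index \<open>b\<close>, so this excludes uncountable right-separated families. After
  thinning, rounded values agree on the root \<open>r\<close>, and the remaining coordinates form a
  large family.\<close>

lemma wave_self_approximating:
  assumes C: "unbounded C" and F: "\<And>b. b \<in> C \<Longrightarrow> finite (F b)"
  shows "\<exists>b\<in>C. \<exists>b'\<in>C. b < b' \<and> (\<forall>x\<in>F b. \<bar>wave b' x - wave b x\<bar> < 1 / real (Suc (n b)))"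
proof -
  obtain p where "unbounded {b \<in> C. (n b, card (F b)) = p}"
    using unbounded_thin[OF C, of "\<lambda>b. (n b, card (F b))"] by blast
  moreover obtain N k where "p = (N, k)" by (cases p)
  ultimately have C1: "unbounded {b \<in> C. (n b, card (F b)) = (N, k)}" by simp
  define C1 where "C1 = {b \<in> C. (n b, card (F b)) = (N, k)}"
  have "finite (F b) \<and> card (F b) = k" if "b \<in> C1" for b using that F by (auto simp: C1_def)
  from maximal_root[of C1 F k, OF C1[folded C1_def] this]
  obtain r where C2: "unbounded {b \<in> C1. r \<subseteq> F b}"
    and max: "\<And>x. x \<notin> r \<Longrightarrow> \<not> unbounded {b \<in> C1. insert x r \<subseteq> F b}" by blast
  define C2 where "C2 = {b \<in> C1. r \<subseteq> F b}"
  obtain b2 where "b2 \<in> C2" using C2 unfolding C2_def unbounded_def by blast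
  then have "finite r" using F finite_subset by (auto simp: C2_def C1_def)
  define f where "f b x = \<lfloor>wave b x * 2 * real (Suc N)\<rfloor>" for b x
  \<comment> \<open>Adjoining \<open>b\<close> itself yields \<open>b < b'\<close> later, as
    \<open>wave_dense\<close> puts all entries below \<open>b'\<close>.\<close>
  define al where "al b = sorted_list_of_set (insert b (F b - r))" for b
  have al: "set (al b) = insert b (F b - r)" "distinct (al b)" if "b \<in> C2" for b
  proof -
    have "finite (insert b (F b - r))" using that F by (auto simp: C2_def C1_def)
    then show "set (al b) = insert b (F b - r)" "distinct (al b)"
      unfolding al_def by (rule set_sorted_list_of_set) (rule distinct_sorted_list_of_set)
  qed
  obtain l where C3: "unbounded {b \<in> C2. (map (f b) (sorted_list_of_set r), map (f b) (al b)) = l}"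
    using unbounded_thin[OF C2[folded C2_def], of "\<lambda>b. (map (f b) (sorted_list_of_set r), map (f b) (al b))"]
    by blast
  define C3 where "C3 = {b \<in> C2. (map (f b) (sorted_list_of_set r), map (f b) (al b)) = l}"
  have C3_r: "f b x = f b' x" if "b \<in> C3" "b' \<in> C3" "x \<in> r" for b b' x
  proof -
    have "map (f b) (sorted_list_of_set r) = map (f b') (sorted_list_of_set r)"
      using that by (auto simp: C3_def)
    then show ?thesis using that(3) \<open>finite r\<close> by simp
  qed
  have C3_al: "length (al b) = length (al b')" "i < length (al b) \<Longrightarrow> f b (al b ! i) = f b' (al b' ! i)"
    if "b \<in> C3" "b' \<in> C3" for b b' i
  proof -
    have *: "map (f b) (al b) = map (f b') (al b')" using that by (auto simp: C3_def)
    then show l: "length (al b) = length (al b')" by (metis length_map)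
    show "f b (al b ! i) = f b' (al b' ! i)" if "i < length (al b)"
      using arg_cong[OF *, of "\<lambda>l. l ! i"] that l by simp
  qed
  obtain b0 where b0: "b0 \<in> C3" using C3 unfolding C3_def unbounded_def by blast
  have "large (al ` C3)" unfolding large_def
  proof
    fix z
    \<comment> \<open>By maximality of \<open>r\<close>, each \<open>x\<close> outside
      \<open>r\<close> occurs together with \<open>r\<close> in \<open>F b\<close> for boundedly
      many \<open>b\<close> only, and \<open>{..z}\<close> is countable.\<close>
    have "\<forall>x\<in>{..z} - r. \<exists>u. \<forall>b\<in>{b \<in> C1. insert x r \<subseteq> F b}. b < u"
      using max not_unbounded by blast
    then obtain u where u: "\<And>x b. x \<le> z \<Longrightarrow> x \<notin> r \<Longrightarrow> b \<in> C1 \<Longrightarrow> insert x r \<subseteq> F b \<Longrightarrow> b < u x"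
      by (metis (no_types, lifting) DiffI atMost_iff mem_Collect_eq)
    obtain w where w: "\<And>x. x \<le> z \<Longrightarrow> u x < w" "z < w"
      using bounded_if_countable_omega1[of "insert z (u ` {..z})"] countable_atMost_omega1 by auto
    obtain b where b: "b \<in> C3" "w < b" using C3 unfolding C3_def unbounded_def by blast
    have bC: "b \<in> C2" using b(1) by (simp add: C3_def)
    have "z < x" if "x \<in> set (al b)" for x
    proof (rule ccontr)
      assume "\<not> z < x"
      then have "x \<le> z" by simp
      then have "x \<in> F b - r" using that al(1)[OF bC] w(2) b(2) by auto
      then have "b < u x" using u[OF \<open>x \<le> z\<close>, of b] bC by (auto simp: C2_def)
      then show False using w(1)[OF \<open>x \<le> z\<close>] b(2) by simp
    qed
    then show "\<exists>a\<in>al ` C3. \<forall>x\<in>set a. z < x" using b(1) by blast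
  qed
  moreover have "distinct a \<and> length a = length (al b0)" if "a \<in> al ` C3" for a
    using that al(2) C3_al(1)[OF _ b0] by (auto simp: C3_def)
  \<comment> \<open>The target values are those of one fixed \<open>b0\<close>. Equal rounding makes
    them accurate for every \<open>b\<close> up to half the tolerance; the other half goes to the
    approximation.\<close>
  ultimately have "\<exists>a\<in>al ` C3. \<exists>b'\<in>C3. \<forall>i<length (al b0). a ! i < b' \<and>
      \<bar>wave b' (a ! i) - wave b0 (al b0 ! i)\<bar> < 1 / (2 * real (Suc N))"
    using C3 abs_ww_le by (intro wave_dense) (auto simp: C3_def)
  then obtain b b' where b: "b \<in> C3" "b' \<in> C3" and
    close: "\<And>i. i < length (al b0) \<Longrightarrow> al b ! i < b' \<and>
      \<bar>wave b' (al b ! i) - wave b0 (al b0 ! i)\<bar> < 1 / (2 * real (Suc N))"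
    by blast
  have bC: "b \<in> C2" "b \<in> C" "b' \<in> C" "n b = N" using b by (auto simp: C3_def C2_def C1_def)
  have len: "length (al b) = length (al b0)" by (rule C3_al(1)[OF b(1) b0])
  have half: "1 / (2 * real (Suc N)) + 1 / (2 * real (Suc N)) = 1 / real (Suc N)"
    by (simp add: field_simps)
  have al_close: "x < b' \<and> \<bar>wave b' x - wave b x\<bar> < 1 / real (Suc N)" if x: "x \<in> set (al b)" for x
  proof -
    obtain i where i: "i < length (al b)" "x = al b ! i"
      using x by (metis in_set_conv_nth)
    have "\<bar>wave b x - wave b0 (al b0 ! i)\<bar> < 1 / (2 * real (Suc N))"
      using floor_eq_imp_close C3_al(2)[OF b(1) b0 i(1)] unfolding f_def i(2) by blast
    then show ?thesis using close[of i] i len half by auto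
  qed
  have "\<bar>wave b' x - wave b x\<bar> < 1 / real (Suc N)" if "x \<in> F b" for x
  proof (cases "x \<in> r")
    case True
    have "\<bar>wave b' x - wave b x\<bar> < 1 / (2 * real (Suc N))"
      using floor_eq_imp_close C3_r[OF b(2,1) True] unfolding f_def by blast
    also have "\<dots> < 1 / real (Suc N)" by (simp add: field_simps)
    finally show ?thesis .
  next
    case False
    then show ?thesis using al_close[of x] that al(1)[OF bC(1)] by simp
  qed
  moreover have "b < b'" using al_close[of b] al(1)[OF bC(1)] by simp
  ultimately show ?thesis using bC by blast
qed

section \<open>Points in a power of the real line\<close>

lemma open_fun_basis:
  fixes h :: "'i \<Rightarrow> real"
  assumes "open U" "h \<in> U"
  shows "\<exists>F n. finite F \<and> (\<forall>h'. (\<forall>x\<in>F. \<bar>h' x - h x\<bar> < 1 / real (Suc n)) \<longrightarrow> h' \<in> U)"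
proof -
  have "openin (product_topology (\<lambda>i. euclideanreal) UNIV) U"
    using assms(1) by (simp add: open_fun_def)
  from product_topology_open_contains_basis[OF this assms(2)]
  obtain X where X: "h \<in> (\<Pi>\<^sub>E i\<in>UNIV. X i)" "\<And>i. open (X i)" "finite {i. X i \<noteq> UNIV}"
    "(\<Pi>\<^sub>E i\<in>UNIV. X i) \<subseteq> U"
    unfolding topspace_euclidean open_openin[symmetric] by blast
  let ?F = "{i. X i \<noteq> UNIV}"
  have "\<exists>e>0. \<forall>y. \<bar>y - h i\<bar> < e \<longrightarrow> y \<in> X i" for i
  proof -
    have "h i \<in> X i" using X(1) by (auto simp: PiE_UNIV_domain)
    then show ?thesis using X(2)[of i] unfolding open_dist dist_real_def by blast
  qed
  then obtain e where e: "\<And>i. e i > 0" "\<And>i y. \<bar>y - h i\<bar> < e i \<Longrightarrow> y \<in> X i" by metis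
  define m where "m = Min (insert 1 (e ` ?F))"
  have "m > 0" unfolding m_def using X(3) e(1) by (subst Min_gr_iff) auto
  have m: "m \<le> e i" if "i \<in> ?F" for i unfolding m_def using X(3) that by (intro Min_le) auto
  obtain n where n: "1 / real (Suc n) < m"
    using reals_Archimedean[OF \<open>m > 0\<close>] by (auto simp: inverse_eq_divide)
  have "h' \<in> U" if "\<forall>x\<in>?F. \<bar>h' x - h x\<bar> < 1 / real (Suc n)" for h'
  proof -
    have "h' i \<in> X i" for i
    proof (cases "i \<in> ?F")
      case True
      then show ?thesis using that n m[OF True] by (intro e(2)) fastforce
    qed auto
    then show ?thesis using X(4) by (auto simp: PiE_UNIV_domain)
  qed
  then show ?thesis using X(3) by blast
qed

text \<open>The coordinates up to \<open>d\<close> are made constant, since only those beyond \<open>d\<close> are known to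
  come simultaneously close to \<open>-1\<close>.\<close>

definition point :: "omega1 \<Rightarrow> omega1 \<Rightarrow> omega1 \<Rightarrow> real" where
  "point d b = (\<lambda>x. if x \<le> d then -1 else wave b x)"

lemma point_Lindelof:
  fixes Y :: "omega1 set" and U :: "omega1 \<Rightarrow> (omega1 \<Rightarrow> real) set"
  assumes U: "\<And>y. y \<in> Y \<Longrightarrow> open (U y) \<and> point d y \<in> U y"
  shows "\<exists>C\<subseteq>Y. countable C \<and> (\<forall>y\<in>Y. \<exists>c\<in>C. point d y \<in> U c)"
proof -
  txt \<open>Greedily select, in increasing order, the points not covered by earlier selected ones.\<close>
  define P where "P s x r \<longleftrightarrow> (r \<longleftrightarrow> x \<in> Y \<and> (\<forall>y<x. s y \<longrightarrow> point d x \<notin> U y))" for s and x :: omega1 and r :: bool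
  have "\<exists>s. \<forall>x. P s x (s x)"
    by (rule dependent_wellorder_choice) (auto simp: P_def)
  then obtain s where s: "\<And>x. s x \<longleftrightarrow> x \<in> Y \<and> (\<forall>y<x. s y \<longrightarrow> point d x \<notin> U y)"
    unfolding P_def by blast
  let ?C = "{x. s x}"
  have "?C \<subseteq> Y" using s by blast
  \<comment> \<open>Otherwise some selected \<open>b'\<close> would lie in the neighbourhood of an
    earlier selected \<open>b\<close>, against its selection.\<close>
  have "\<not> unbounded ?C"
  proof
    assume unbounded: "unbounded ?C"
    have "\<forall>b\<in>?C. \<exists>F n. finite F \<and> (\<forall>h'. (\<forall>x\<in>F. \<bar>h' x - point d b x\<bar> < 1 / real (Suc n)) \<longrightarrow> h' \<in> U b)"
      using open_fun_basis U \<open>?C \<subseteq> Y\<close> by blast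
    then obtain F n where F: "\<And>b. s b \<Longrightarrow> finite (F b)"
      "\<And>b h'. s b \<Longrightarrow> (\<forall>x\<in>F b. \<bar>h' x - point d b x\<bar> < 1 / real (Suc (n b))) \<Longrightarrow> h' \<in> U b"
      by (metis mem_Collect_eq)
    obtain b b' where b: "s b" "s b'" "b < b'" "\<forall>x\<in>F b. \<bar>wave b' x - wave b x\<bar> < 1 / real (Suc (n b))"
      using wave_self_approximating[OF unbounded, of F n] F(1) by blast
    have "\<forall>x\<in>F b. \<bar>point d b' x - point d b x\<bar> < 1 / real (Suc (n b))"
      using b(4) by (auto simp: point_def)
    then have "point d b' \<in> U b" by (rule F(2)[OF b(1)])
    then show False using s[of b'] b(1-3) by blast
  qed
  then obtain c where "?C \<subseteq> {..<c}" unfolding not_unbounded by auto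
  then have "countable ?C" using countable_lessThan_omega1 countable_subset by blast
  moreover have "\<exists>c\<in>?C. point d y \<in> U c" if "y \<in> Y" for y
    using s[of y] U[OF that] that by blast
  ultimately show ?thesis using \<open>?C \<subseteq> Y\<close> by blast
qed

text \<open>For \<open>b < b'\<close>, coordinate \<open>b\<close> is 1 at the first point and
  different from 1 at the second.\<close>

lemma point_inj:
  assumes "d < b" "d < b'" "point d b = point d b'"
  shows "b = b'"
proof -
  have *: False if "d < b" "b < b'" "point d b = point d b'" for b b'
  proof -
    have "point d b b = point d b' b" using that(3) by simp
    then have "1 = wave b' b" using that wave_eq_1[of b b] by (simp add: point_def split: if_splits)
    then show False using wave_ne_1[OF that(2)] by simp
  qed
  show ?thesis using *[of b b'] *[of b' b] assms by (metis linorder_neqE)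
qed

lemma point_ne: "d < b \<Longrightarrow> point d b \<noteq> (\<lambda>_. -1)"
  using gt_ex_omega1[of d] wave_ne_m1 unfolding point_def by (metis not_less)

text \<open>Transports a space of functions to a carrier of reals, as the statement
  requires.\<close>

lemma Tychonoff_pullback:
  assumes inj: "inj_on f S" and T: "Tychonoff_space T" and f: "f ` S \<subseteq> topspace T"
  shows "Tychonoff_space (pullback_topology S f T)"
proof -
  let ?X = "pullback_topology S f T"
  have top: "topspace ?X = S" using f by (auto simp: topspace_pullback_topology)
  have cont: "continuous_map ?X T f"
    using continuous_map_pullback[OF continuous_map_id, of S f T] by simp
  have "Hausdorff_space ?X" unfolding Hausdorff_space_def top
  proof (intro allI impI)
    fix x y assume xy: "x \<in> S \<and> y \<in> S \<and> x \<noteq> y"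
    then have "f x \<in> topspace T" "f y \<in> topspace T" "f x \<noteq> f y"
      using inj f by (auto dest: inj_onD)
    then obtain U V where UV: "openin T U" "openin T V" "f x \<in> U" "f y \<in> V" "disjnt U V"
      using T unfolding Tychonoff_space_def Hausdorff_space_def by blast
    show "\<exists>U V. openin ?X U \<and> openin ?X V \<and> x \<in> U \<and> y \<in> V \<and> disjnt U V"
      using UV xy by (intro exI[of _ "f -` U \<inter> S"] exI[of _ "f -` V \<inter> S"])
        (auto simp: openin_pullback_topology disjnt_def)
  qed
  moreover have "completely_regular_space ?X" unfolding completely_regular_space_alt'
  proof (intro allI impI)
    fix U x assume "openin ?X U" "x \<in> U"
    then obtain V where V: "openin T V" "U = f -` V \<inter> S" "f x \<in> V" "x \<in> S"
      by (auto simp: openin_pullback_topology)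
    then obtain g where g: "continuous_map T euclideanreal g" "g (f x) = 0" "g ` (topspace T - V) \<subseteq> {1}"
      using T unfolding Tychonoff_space_def completely_regular_space_alt' by blast
    have "g (f y) = 1" if "y \<in> S" "f y \<notin> V" for y
      using that g(3) f by (metis DiffI image_subset_iff singletonD)
    then have "(g \<circ> f) ` (topspace ?X - U) \<subseteq> {1}"
      unfolding top V(2) by auto
    moreover have "continuous_map ?X euclideanreal (g \<circ> f)"
      by (rule continuous_map_compose[OF cont g(1)])
    ultimately show "\<exists>f. continuous_map ?X euclideanreal f \<and> f x = 0 \<and> f ` (topspace ?X - U) \<subseteq> {1}"
      using g(2) by (intro exI[of _ "g \<circ> f"]) auto
  qed
  ultimately show ?thesis by (simp add: Tychonoff_space_def)
qed

lemma Tychonoff_fun: "Tychonoff_space (euclidean :: ('i \<Rightarrow> real) topology)"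
  unfolding Tychonoff_space_def euclidean_product_topology[symmetric]
  by (simp add: completely_regular_space_product_topology Hausdorff_space_product_topology
      metrizable_imp_completely_regular_space metrizable_space_euclidean)

theorem mainTheorem5:
  shows "\<exists>X :: real topology.
    Tychonoff_space X \<and> hL_tight_space X \<and> \<not> sigma_compact_tight_space X"
proof -
  have "unbounded UNIV" unfolding unbounded_def using gt_ex_omega1 by blast
  then obtain d where d: "\<And>F e. finite F \<Longrightarrow> \<forall>x\<in>F. d < x \<Longrightarrow> e > 0 \<Longrightarrow>
      \<exists>b\<in>UNIV. \<forall>x\<in>F. x < b \<and> \<bar>wave b x - (-1)\<bar> < e"
    by (rule wave_near_m1) (rule that, blast)
  txt \<open>The exponential keeps the label \<open>0\<close> free for the limit point, the constant function \<open>-1\<close>.\<close>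
  define q where "q b = exp (Rep_omega1 b)" for b
  define f where "f x = (if x = 0 then \<lambda>_. -1 else point d (Abs_omega1 (ln x)))" for x
  have f0: "f 0 = (\<lambda>_. -1)" by (simp add: f_def)
  have fq: "f (q b) = point d b" for b by (simp add: f_def q_def Rep_omega1_inverse)
  have q_pos: "q b > 0" for b by (simp add: q_def)
  \<comment> \<open>All indices \<open>b \<le> d\<close> would give one and the same
    function.\<close>
  define Q where "Q = q ` {d<..}"
  define S where "S = insert 0 Q"
  define X where "X = pullback_topology S f euclidean"
  have top: "topspace X = S" by (simp add: X_def topspace_pullback_topology)
  have op: "openin X V \<longleftrightarrow> (\<exists>U. open U \<and> V = f -` U \<inter> S)" for V
    by (simp add: X_def openin_pullback_topology)
  have Q: "\<exists>b>d. x = q b" if "x \<in> Q" for x using that by (auto simp: Q_def)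
  have "inj_on f Q"
  proof (rule inj_onI)
    fix x y assume "x \<in> Q" "y \<in> Q" and eq: "f x = f y"
    then obtain b b' where b: "d < b" "x = q b" "d < b'" "y = q b'" using Q by blast
    then have "b = b'" using point_inj[of d b b'] eq by (simp add: fq)
    then show "x = y" using b by simp
  qed
  moreover have "f 0 \<noteq> f x" if "x \<in> Q" for x
    using Q[OF that] point_ne f0 fq by metis
  ultimately have "inj_on f S" unfolding S_def inj_on_insert by blast
  then have Tych: "Tychonoff_space X"
    unfolding X_def by (intro Tychonoff_pullback Tychonoff_fun) auto

  have "hereditarily Lindelof_space X"
    unfolding hereditarily_def Lindelof_space_subtopology
  proof (intro allI impI)
    fix Z \<U>
    assume "Z \<subseteq> topspace X" and \<U>: "(\<forall>U\<in>\<U>. openin X U) \<and> topspace X \<inter> Z \<subseteq> \<Union>\<U>"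
    then have Z: "Z \<subseteq> S" "Z \<subseteq> \<Union>\<U>" using top by auto
    then have "\<forall>x\<in>Z. \<exists>U\<in>\<U>. x \<in> U" by blast
    then obtain W where W: "\<And>x. x \<in> Z \<Longrightarrow> W x \<in> \<U>" "\<And>x. x \<in> Z \<Longrightarrow> x \<in> W x" by metis
    have "\<exists>G. open G \<and> W x = f -` G \<inter> S" if "x \<in> Z" for x
      using W(1)[OF that] \<U> op by simp
    then obtain G where G: "\<And>x. x \<in> Z \<Longrightarrow> open (G x)" "\<And>x. x \<in> Z \<Longrightarrow> W x = f -` G x \<inter> S" by metis
    define Y where "Y = {b. d < b \<and> q b \<in> Z}"
    have "open (G (q y)) \<and> point d y \<in> G (q y)" if "y \<in> Y" for y
    proof -
      have "q y \<in> Z" using that by (simp add: Y_def)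
      then show ?thesis using G[of "q y"] W(2)[of "q y"] by (simp add: fq)
    qed
    from point_Lindelof[of Y "\<lambda>y. G (q y)" d, OF this] obtain C where
      C: "C \<subseteq> Y" "countable C" "\<And>y. y \<in> Y \<Longrightarrow> \<exists>c\<in>C. point d y \<in> G (q c)" by blast
    \<comment> \<open>The label 0 carries no index and gets a member of the cover of its
      own.\<close>
    let ?V = "W ` (q ` C \<union> (Z \<inter> {0}))"
    have "?V \<subseteq> \<U>" using W(1) C(1) by (auto simp: Y_def)
    moreover have "countable ?V" using C(2) by simp
    moreover have "x \<in> \<Union>?V" if x: "x \<in> Z" for x
    proof (cases "x = 0")
      case True
      then show ?thesis using x W(2) by blast
    next
      case False
      then obtain b where b: "d < b" "x = q b" using x Z(1) Q by (auto simp: S_def)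
      then have "b \<in> Y" using x by (simp add: Y_def)
      then obtain c where c: "c \<in> C" "point d b \<in> G (q c)" using C(3) by blast
      have "q c \<in> Z" using c(1) C(1) by (auto simp: Y_def)
      then have "x \<in> W (q c)" using G(2)[of "q c"] c(2) b(2) x Z(1) by (auto simp: fq)
      then show ?thesis using c(1) by blast
    qed
    ultimately show "\<exists>V. countable V \<and> V \<subseteq> \<U> \<and> topspace X \<inter> Z \<subseteq> \<Union>V" by (metis Int_iff subsetI)
  qed
  then have "hL_tight_space X"
    unfolding tight_space_def using hereditarily_subtopology by blast

  moreover have "\<not> sigma_compact_tight_space X"
  proof
    assume "sigma_compact_tight_space X"
    moreover have "0 \<in> topspace X" "Q \<subseteq> topspace X" unfolding top S_def by auto
    moreover have "0 \<in> X closure_of Q" unfolding in_closure_of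
    proof (intro conjI allI impI)
      show "0 \<in> topspace X" by fact
      fix V assume V: "0 \<in> V \<and> openin X V"
      then obtain U where U: "open U" "V = f -` U \<inter> S" using op by blast
      then have U0: "(\<lambda>_. -1) \<in> U" using V f0 by simp
      obtain F n where F: "finite F" "\<And>h'. \<forall>x\<in>F. \<bar>h' x - (-1)\<bar> < 1 / real (Suc n) \<Longrightarrow> h' \<in> U"
        using open_fun_basis[OF U(1) U0] by blast
      obtain d' where "d < d'" using gt_ex_omega1 by blast
      \<comment> \<open>The extra coordinate \<open>d'\<close> guarantees \<open>d < b\<close> even
        when \<open>F\<close> has no coordinate beyond \<open>d\<close>.\<close>
      let ?F = "insert d' {x \<in> F. d < x}"
      have "finite ?F" "\<forall>x\<in>?F. d < x" "1 / real (Suc n) > 0" using F(1) \<open>d < d'\<close> by auto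
      from d[OF this] obtain b where b: "\<forall>x\<in>?F. x < b \<and> \<bar>wave b x - (-1)\<bar> < 1 / real (Suc n)"
        by (rule bexE)
      have "\<bar>point d b x - (-1)\<bar> < 1 / real (Suc n)" if "x \<in> F" for x
        using b that by (cases "x \<le> d") (auto simp: point_def)
      then have "point d b \<in> U" by (intro F(2)) blast
      moreover have "d < b" using b \<open>d < d'\<close> by auto
      ultimately have "q b \<in> Q" "q b \<in> V" using U(2) fq by (auto simp: Q_def S_def)
      then show "\<exists>y. y \<in> Q \<and> y \<in> V" by blast
    qed
    ultimately obtain B where B: "B \<subseteq> Q" "0 \<in> X closure_of B" "sigma_compact_space (subtopology X B)"
      unfolding tight_space_def by blast
    then obtain \<K> where K: "countable \<K>" "\<And>K. K \<in> \<K> \<Longrightarrow> compactin (subtopology X B) K"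
      "\<Union>\<K> = topspace (subtopology X B)"
      unfolding sigma_compact_space_def by blast
    have KB: "\<Union>\<K> = B" using K(3) B(1) top S_def by auto
    have coord: "continuous_map X euclideanreal (\<lambda>x. f x i)" for i
    proof -
      have "continuous_map euclidean euclideanreal (\<lambda>h :: omega1 \<Rightarrow> real. h i)"
        using continuous_map_product_coordinates[of i UNIV "\<lambda>_. euclideanreal"]
        by (simp add: euclidean_product_topology)
      from continuous_map_pullback[OF this, of S f] show ?thesis by (simp add: X_def o_def)
    qed
    have "\<not> unbounded {b. d < b \<and> q b \<in> K}" if K_in: "K \<in> \<K>" for K
    proof
      assume "unbounded {b. d < b \<and> q b \<in> K}"
      then obtain d1 where d1: "\<And>F e. finite F \<Longrightarrow> \<forall>x\<in>F. d1 < x \<Longrightarrow> e > 0 \<Longrightarrow>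
          \<exists>b\<in>{b. d < b \<and> q b \<in> K}. \<forall>x\<in>F. x < b \<and> \<bar>wave b x - (-1)\<bar> < e"
        by (rule wave_near_m1) (rule that, blast)
      \<comment> \<open>Beyond \<open>d\<close> the coordinate shows the wave; beyond
        \<open>d1\<close> the waves with label in \<open>K\<close> come arbitrarily close to -1
        there.\<close>
      obtain i where i: "max d d1 < i" using gt_ex_omega1 by blast
      let ?I = "(\<lambda>x. f x i) ` K"
      have "compactin X K" using K(2)[OF K_in] by (simp add: compactin_subtopology)
      then have "closed ?I"
        using image_compactin[OF _ coord, of K i] compact_imp_closed by simp
      moreover have "\<exists>y\<in>?I. dist y (-1) < e" if e: "e > 0" for e
      proof -
        obtain b where b: "d < b" "q b \<in> K" "\<bar>wave b i - (-1)\<bar> < e"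
          using d1[of "{i}" e] i e by auto
        have "f (q b) i = wave b i" using i by (auto simp: fq point_def)
        then show ?thesis using b
          by (intro bexI[of _ "f (q b) i"] image_eqI[of _ _ "q b"]) (auto simp: dist_real_def)
      qed
      ultimately have "-1 \<in> ?I"
        using closure_approachable[of "-1" ?I] closure_closed[of ?I] by simp
      then obtain x where x: "x \<in> K" "f x i = -1" by auto
      obtain b where "x = q b" using x(1) K_in KB B(1) Q by blast
      moreover have "\<not> i \<le> d" using i by auto
      ultimately show False using x(2) wave_ne_m1[of b i] by (simp add: fq point_def)
    qed
    then have "\<forall>K\<in>\<K>. \<exists>u. \<forall>b. d < b \<longrightarrow> q b \<in> K \<longrightarrow> b < u" unfolding not_unbounded by blast
    then obtain u where u: "\<And>K b. K \<in> \<K> \<Longrightarrow> d < b \<Longrightarrow> q b \<in> K \<Longrightarrow> b < u K" by metis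
    \<comment> \<open>In a coordinate \<open>w\<close> beyond \<open>d\<close> and beyond all
      indices that occur in \<open>B\<close>, every point of \<open>B\<close> has value 1, but the
      limit point has value -1.\<close>
    obtain w where w: "\<And>K. K \<in> \<K> \<Longrightarrow> u K < w" "d < w"
      using bounded_if_countable_omega1[of "insert d (u ` \<K>)"] K(1) by auto
    have one: "f x w = 1" if x: "x \<in> B" for x
    proof -
      obtain K where K': "K \<in> \<K>" "x \<in> K" using x KB by blast
      obtain b where b: "d < b" "x = q b" using x B(1) Q by blast
      have "b < w" using u[OF K'(1) b(1)] w(1)[OF K'(1)] K'(2) b(2) by auto
      then show ?thesis using w(2) by (auto simp: b(2) fq point_def wave_eq_1)
    qed
    let ?V = "{x \<in> topspace X. f x w \<in> {..<0}}"
    have "openin X ?V"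
      by (rule openin_continuous_map_preimage[OF coord]) simp
    moreover have "0 \<in> ?V" using f0 top by (simp add: S_def)
    ultimately have "\<exists>y. y \<in> B \<and> y \<in> ?V"
      by (intro B(2)[unfolded in_closure_of, THEN conjunct2, THEN spec[of _ ?V], THEN mp] conjI)
    then obtain y where "y \<in> B" "f y w < 0" by auto
    then show False using one[of y] by simp
  qed
  ultimately show ?thesis using Tych by blast
qed

end
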